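(* The numbers $SB_n$ are recursively characterized by $SB_0=0$, $SB_1=1$ and, for all $n\geq 2$, $$SB_n=\frac{11n^2+11n-6}{(n+4)(n+3)}\,SB_{n-1}+\frac{(n-3)(n-2)}{(n+4)(n+3)}\,SB_{n-2}.$$
   Context: For $n\geq 1$, $SB_n$ is the number of semi-Baxter permutations of size $n$, i.e. permutations $\pi$ of $\{1,\dots,n\}$ with no indices $i<j$ and $k>j+1$ such that $\pi_{j+1}<\pi_i<\pi_k<\pi_j$. By convention $SB_0=0$. *)

theory Defs
  imports Complex_Main "HOL-Combinatorics.Permutations"
begin

definition semi_baxter :: "nat \<Rightarrow> (nat \<Rightarrow> nat) \<Rightarrow> bool" where
  "semi_baxter n \<pi> \<longleftrightarrow>
     \<pi> permutes {1..n} \<and>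
     \<not> (\<exists>i j k. 1 \<le> i \<and> i < j \<and> j + 1 < k \<and> k \<le> n \<and>
          \<pi> (j + 1) < \<pi> i \<and> \<pi> i < \<pi> k \<and> \<pi> k < \<pi> j)"

text \<open>The value at 0 is a convention: the empty permutation is not counted.\<close>

definition SB :: "nat \<Rightarrow> nat" where
  "SB n = (if n = 0 then 0 else card {\<pi>. semi_baxter n \<pi>})"

end

theory Submission
  imports Defs "HOL-Computational_Algebra.Formal_Power_Series" "HOL-Computational_Algebra.Polynomial"
begin

text \<open>
  Appending a last entry to a semi-Baxter permutation keeps it semi-Baxter exactly when the new value
  is an active site, and the tree of all such insertions is governed by two labels: the number \<open>h\<close> of
  active sites at or below the last entry, and the number \<open>k\<close> of those above it. Its children are
  labelled \<open>(i, k + 1)\<close> for \<open>1 \<le> i \<le> h\<close> and \<open>(h + i, k + 1 - i)\<close> for \<open>1 \<le> i \<le> k\<close>. Summing \<open>y\<^sup>h z\<^sup>k\<close>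
  over all permutations of one size gives a polynomial \<open>label_poly n y z\<close>, and summing the rule over the
  tree gives a linear equation \<open>label_poly_Suc\<close> with two catalytic variables. What is wanted is its
  value at \<open>y = z = 1\<close>, where the equation itself degenerates.

  The equation is solved by the kernel method. With \<open>y = 1 + a\<close> the coefficient of the full generating
  function vanishes when \<open>z = 1 + a + w\<close> and
  \<open>x = X(w) = a w / ((1 + a) (1 + a + w) (a + w))\<close>; this leaves a linear relation between the
  specialisations \<open>A(z)\<close> and \<open>B(a)\<close> at \<open>(1, z)\<close> and \<open>(1 + a, 1 + a)\<close>. The kernel is invariant under
  two involutions, one changing \<open>z\<close> and one changing \<open>a\<close>. Starting from \<open>(a, 1 + a + w)\<close> and applying
  them alternately, the fifth pair has \<open>z = 1 + 1/a\<close>, which is free of \<open>w\<close>. The five relations eliminate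
  everything except \<open>B(a)\<close> and \<open>A(1 + 1/a)\<close>, and \<open>B(a) + X (1 + a)\<^sup>2 / a\<^sup>4 A(1 + 1/a)\<close> turns out to be an
  explicit polynomial in \<open>w\<close> (\<open>orbit_elimination\<close>). Choosing \<open>w\<close> and not \<open>x\<close> as the variable of the
  power series keeps every substituted quantity rational, so no algebraic series has to be solved for;
  the coefficients with respect to \<open>x\<close> are recovered by Lagrange inversion.

  The unknown \<open>A\<close> disappears on passing to constant terms in \<open>a\<close>: \<open>(1 + a)\<^sup>2 / a\<^sup>4\<close> times a polynomial
  in \<open>1/a\<close> has only negative powers of \<open>a\<close>, while the constant term of \<open>label_poly n (1 + a) (1 + a)\<close> is the
  number of permutations. So \<open>SB n\<close> is a finite sum of products of three binomial coefficients. One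
  telescoping certificate condenses it to the hypergeometric sum of \<open>SB_closed_form\<close>, and a second one
  is Zeilberger's proof of the recurrence for that sum.
\<close>

section \<open>Growing semi-Baxter permutations by a last entry\<close>

definition shift :: "nat \<Rightarrow> nat \<Rightarrow> nat" where
  "shift p v = (if v < p then v else Suc v)"

definition append_value :: "nat \<Rightarrow> nat \<Rightarrow> (nat \<Rightarrow> nat) \<Rightarrow> nat \<Rightarrow> nat" where
  "append_value n p \<pi> =
     (\<lambda>i. if i = Suc n then p else if i \<in> {1..n} then shift p (\<pi> i) else i)"

lemma append_value_last [simp]: "append_value n p \<pi> (Suc n) = p"
  by (simp add: append_value_def)

lemma append_value_old: "1 \<le> i \<Longrightarrow> i \<le> n \<Longrightarrow> append_value n p \<pi> i = shift p (\<pi> i)"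
  by (simp add: append_value_def)

lemma shift_less_shift [simp]: "shift p u < shift p v \<longleftrightarrow> u < v"
  by (auto simp: shift_def)

lemma shift_eq_shift [simp]: "shift p u = shift p v \<longleftrightarrow> u = v"
  by (auto simp: shift_def)

lemma shift_neq [simp]: "shift p v \<noteq> p"
  by (auto simp: shift_def)

lemma shift_less_iff: "shift p v < q \<longleftrightarrow> v < (if q \<le> p then q else q - 1)"
  by (auto simp: shift_def)

lemma less_shift_iff: "p < shift p v \<longleftrightarrow> p \<le> v"
  by (auto simp: shift_def)

lemma append_value_permutes:
  assumes "\<pi> permutes {1..n}" and "p \<in> {1..Suc n}"
  shows "append_value n p \<pi> permutes {1..Suc n}"
proof (rule inj_imp_permutes)
  have range: "\<pi> i \<in> {1..n}" if "i \<in> {1..n}" for i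
    using permutes_in_image[OF assms(1)] that by blast
  show "inj_on (append_value n p \<pi>) {1..Suc n}"
  proof (rule inj_onI)
    fix i j
    assume ij: "i \<in> {1..Suc n}" "j \<in> {1..Suc n}"
      and eq: "append_value n p \<pi> i = append_value n p \<pi> j"
    show "i = j"
    proof (cases "i = Suc n \<or> j = Suc n")
      case True
      then show ?thesis
        using ij eq by (auto simp: append_value_def shift_neq[symmetric] split: if_splits)
    next
      case False
      then have "\<pi> i = \<pi> j" using ij eq by (simp add: append_value_old)
      then show ?thesis using permutes_inj[OF assms(1)] by (blast dest: injD)
    qed
  qed
  show "append_value n p \<pi> i \<in> {1..Suc n}" if "i \<in> {1..Suc n}" for i
    using that assms(2) range[of i] by (auto simp: append_value_def shift_def)
qed (auto simp: append_value_def)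

text \<open>
  Injectivity is clear, since the last value and the relative order of the others can be read off.
  Surjectivity then needs no construction of an inverse: both sides have \<open>(n + 1)!\<close> elements.
\<close>

lemma append_value_bij:
  "bij_betw (\<lambda>(\<pi>, p). append_value n p \<pi>)
     ({\<pi>. \<pi> permutes {1..n}} \<times> {1..Suc n}) {\<sigma>. \<sigma> permutes {1..Suc n}}"
proof -
  let ?A = "{\<pi>. \<pi> permutes {1..n}} \<times> {1..Suc n}" and ?f = "\<lambda>(\<pi>, p). append_value n p \<pi>"
  have inj: "inj_on ?f ?A"
  proof (rule inj_onI, clarsimp)
    fix \<pi> \<rho> p q
    assume perm: "\<pi> permutes {Suc 0..n}" "\<rho> permutes {Suc 0..n}"
      and eq: "append_value n p \<pi> = append_value n q \<rho>"
    from fun_cong[OF eq, of "Suc n"] have "p = q" by simp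
    moreover have "\<pi> i = \<rho> i" for i
    proof (cases "i \<in> {1..n}")
      case True
      with fun_cong[OF eq, of i] \<open>p = q\<close> show ?thesis
        by (simp add: append_value_old)
    next
      case False
      with perm show ?thesis by (simp add: permutes_def)
    qed
    ultimately show "\<pi> = \<rho> \<and> p = q" by auto
  qed
  have sub: "?f ` ?A \<subseteq> {\<sigma>. \<sigma> permutes {1..Suc n}}"
    using append_value_permutes by auto
  have "card (?f ` ?A) = fact n * Suc n"
    using card_image[OF inj] card_permutations[of "{1..n}" n] by (simp add: card_cartesian_product)
  also have "\<dots> = card {\<sigma>. \<sigma> permutes {1..Suc n}}"
    using card_permutations[of "{1..Suc n}" "Suc n"] by (simp add: algebra_simps)
  finally have "?f ` ?A = {\<sigma>. \<sigma> permutes {1..Suc n}}"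
    using card_subset_eq[OF _ sub] finite_permutations[of "{1..Suc n}"] by simp
  with inj show ?thesis by (simp add: bij_betw_def)
qed

text \<open>
  A value \<open>p\<close> placed at the end plays the role of \<open>\<pi> k\<close> in a forbidden pattern. It is compared with
  the old values before they are shifted, which is why the upper bound is \<open>p \<le> \<pi> j\<close> and not strict.
\<close>

definition active :: "nat \<Rightarrow> (nat \<Rightarrow> nat) \<Rightarrow> nat set" where
  "active n \<pi> = {p \<in> {1..Suc n}. \<not> (\<exists>i j. 1 \<le> i \<and> i < j \<and> j < n \<and>
      \<pi> (j + 1) < \<pi> i \<and> \<pi> i < p \<and> p \<le> \<pi> j)}"

lemma finite_active [simp]: "finite (active n \<pi>)"
  by (simp add: active_def)

lemma semi_baxter_append_value:
  assumes "\<pi> permutes {1..n}" and "p \<in> {1..Suc n}"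
  shows "semi_baxter (Suc n) (append_value n p \<pi>) \<longleftrightarrow> semi_baxter n \<pi> \<and> p \<in> active n \<pi>"
proof -
  let ?P = "\<lambda>\<sigma> i j k. 1 \<le> i \<and> i < j \<and> j + 1 < k \<and>
          \<sigma> (j + 1) < \<sigma> i \<and> \<sigma> i < \<sigma> k \<and> \<sigma> k < \<sigma> j"
  let ?\<sigma> = "append_value n p \<pi>"
  have old: "?P ?\<sigma> i j k \<longleftrightarrow> ?P \<pi> i j k" if "k \<le> n" for i j k
    using that by (auto simp: append_value_old)
  have new: "?P ?\<sigma> i j (Suc n) \<longleftrightarrow>
      1 \<le> i \<and> i < j \<and> j < n \<and> \<pi> (j + 1) < \<pi> i \<and> \<pi> i < p \<and> p \<le> \<pi> j" for i j
    by (auto simp: append_value_old shift_less_iff[of p _ p] less_shift_iff)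
  let ?B = "\<lambda>\<sigma> m. \<exists>i j k. ?P \<sigma> i j k \<and> k \<le> m"
  have split: "?B ?\<sigma> (Suc n) \<longleftrightarrow> ?B \<pi> n \<or> (\<exists>i j. ?P ?\<sigma> i j (Suc n))"
  proof (intro iffI; elim exE disjE)
    fix i j k assume "?P ?\<sigma> i j k \<and> k \<le> Suc n"
    then show "?B \<pi> n \<or> (\<exists>i j. ?P ?\<sigma> i j (Suc n))"
      using old[of k i j] by (cases "k = Suc n") (blast, metis le_Suc_eq)
  next
    fix i j k assume "?P \<pi> i j k \<and> k \<le> n"
    then show "?B ?\<sigma> (Suc n)" using old[of k i j] le_SucI by blast
  next
    fix i j assume "?P ?\<sigma> i j (Suc n)"
    then show "?B ?\<sigma> (Suc n)" by blast
  qed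
  have semi: "semi_baxter m \<sigma> \<longleftrightarrow> \<sigma> permutes {1..m} \<and> \<not> ?B \<sigma> m" for m \<sigma>
    unfolding semi_baxter_def by (simp only: conj_ac)
  have act: "p \<in> active n \<pi> \<longleftrightarrow> \<not> (\<exists>i j. ?P ?\<sigma> i j (Suc n))"
    using assms(2) unfolding active_def new by (simp only: mem_Collect_eq simp_thms)
  show ?thesis
    using assms(1) append_value_permutes[OF assms]
    by (simp only: semi split act de_Morgan_disj simp_thms)
qed

text \<open>
  A descent \<open>j\<close> of \<open>\<pi>\<close> blocks the site \<open>q\<close> after the insertion exactly when it blocked the site from
  which \<open>q\<close> arises, namely \<open>q\<close> or \<open>q - 1\<close>. The only new obstruction comes from the descent to the
  inserted value, present if \<open>p \<le> \<pi> n\<close>; it blocks the sites from above some old value in between up to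
  the former last entry.
\<close>

lemma active_append_value:
  assumes n: "1 \<le> n" and p: "p \<in> {1..Suc n}"
  shows "q \<in> active (Suc n) (append_value n p \<pi>) \<longleftrightarrow>
           q \<in> {1..Suc (Suc n)} \<and> (if q \<le> p then q else q - 1) \<in> active n \<pi> \<and>
           \<not> (\<exists>i. 1 \<le> i \<and> i < n \<and> p \<le> \<pi> i \<and> Suc (\<pi> i) < q \<and> q \<le> Suc (\<pi> n) \<and> p \<le> \<pi> n)"
proof -
  let ?\<sigma> = "append_value n p \<pi>" and ?q = "if q \<le> p then q else q - 1"
  let ?P = "\<lambda>\<sigma> q i j. 1 \<le> i \<and> i < j \<and> \<sigma> (j + 1) < \<sigma> i \<and> \<sigma> i < q \<and> q \<le> \<sigma> j"
  have old: "?P ?\<sigma> q i j \<longleftrightarrow> ?P \<pi> ?q i j" if "j < n" for i j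
  proof (cases "1 \<le> i \<and> i < j")
    case True
    with that have "?\<sigma> i = shift p (\<pi> i)" "?\<sigma> j = shift p (\<pi> j)" "?\<sigma> (j + 1) = shift p (\<pi> (j + 1))"
      by (auto intro!: append_value_old)
    then show ?thesis by (simp add: shift_less_iff[of p _ q] not_less[symmetric] del: not_less)
  qed auto
  have new: "?P ?\<sigma> q i n \<longleftrightarrow> 1 \<le> i \<and> i < n \<and> p \<le> \<pi> i \<and> Suc (\<pi> i) < q \<and> q \<le> Suc (\<pi> n) \<and> p \<le> \<pi> n" for i
    using n by (auto simp: append_value_old shift_def split: if_splits)
  have "(\<exists>i j. ?P ?\<sigma> q i j \<and> j < Suc n) \<longleftrightarrow> (\<exists>i j. ?P \<pi> ?q i j \<and> j < n) \<or> (\<exists>i. ?P ?\<sigma> q i n)"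
    unfolding less_Suc_eq using old by blast
  moreover have "q \<in> {1..Suc (Suc n)} \<Longrightarrow> ?q \<in> {1..Suc n}"
    using p by auto
  moreover have act: "r \<in> active m \<sigma> \<longleftrightarrow> r \<in> {1..Suc m} \<and> \<not> (\<exists>i j. ?P \<sigma> r i j \<and> j < m)" for r m \<sigma>
    unfolding active_def mem_Collect_eq by (simp only: conj_ac)
  ultimately show ?thesis
    unfolding act new by blast
qed

lemma active_subset: "q \<in> active n \<pi> \<Longrightarrow> 1 \<le> q \<and> q \<le> Suc n"
  by (simp add: active_def)

text \<open>
  An ascent creates no obstruction: all sites survive, and the site \<open>p\<close> itself splits into \<open>p\<close> and
  \<open>p + 1\<close>.
\<close>

lemma active_append_above:
  assumes n: "1 \<le> n" and p: "p \<in> active n \<pi>" and above: "\<pi> n < p"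
  shows "active (Suc n) (append_value n p \<pi>) =
           {q \<in> active n \<pi>. q \<le> p} \<union> Suc ` {q \<in> active n \<pi>. p \<le> q}"
proof (rule set_eqI)
  fix q
  have "p \<in> {1..Suc n}" using active_subset[OF p] by simp
  then have iff: "q \<in> active (Suc n) (append_value n p \<pi>) \<longleftrightarrow>
      q \<in> {1..Suc (Suc n)} \<and> (if q \<le> p then q else q - 1) \<in> active n \<pi>"
    using active_append_value[OF n] above by auto
  show "q \<in> active (Suc n) (append_value n p \<pi>) \<longleftrightarrow>
      q \<in> {q \<in> active n \<pi>. q \<le> p} \<union> Suc ` {q \<in> active n \<pi>. p \<le> q}"
    unfolding iff by (cases q) (auto dest: active_subset)
qed

text \<open>
  A descent destroys all sites above the new value up to the former last entry, except \<open>p + 1\<close>: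
  above it, the old value \<open>p\<close> (now \<open>p + 1\<close>) completes a blocking triple.
\<close>

lemma active_append_below:
  assumes perm: "\<pi> permutes {1..n}" and n: "1 \<le> n" and p: "p \<in> active n \<pi>" and below: "p \<le> \<pi> n"
  shows "active (Suc n) (append_value n p \<pi>) =
           {q \<in> active n \<pi>. q \<le> p} \<union> {Suc p} \<union> Suc ` {q \<in> active n \<pi>. \<pi> n < q}"
proof (rule set_eqI)
  fix q
  have p1: "p \<in> {1..Suc n}" using active_subset[OF p] by simp
  \<comment> \<open>The entry of value p serves as witness for every blocked site at once.\<close>
  have "\<pi> n \<in> {1..n}" using permutes_in_image[OF perm] n by simp
  then have "p \<in> {1..n}" using p1 below by simp
  then obtain i where i: "i \<in> {1..n}" "\<pi> i = p"
    using permutes_image[OF perm] by (metis imageE)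
  have new: "(\<exists>i. 1 \<le> i \<and> i < n \<and> p \<le> \<pi> i \<and> Suc (\<pi> i) < q \<and> q \<le> Suc (\<pi> n) \<and> p \<le> \<pi> n)
       \<longleftrightarrow> Suc p < q \<and> q \<le> Suc (\<pi> n)" (is "?L \<longleftrightarrow> ?R")
  proof
    assume ?R
    then have "i \<noteq> n" using i by auto
    with \<open>?R\<close> i below show ?L by (intro exI[of _ i]) auto
  qed auto
  show "q \<in> active (Suc n) (append_value n p \<pi>) \<longleftrightarrow>
      q \<in> {q \<in> active n \<pi>. q \<le> p} \<union> {Suc p} \<union> Suc ` {q \<in> active n \<pi>. \<pi> n < q}"
    unfolding active_append_value[OF n p1] new
    using p below by (cases q) (auto dest: active_subset)
qed

section \<open>The generating tree as a functional equation\<close>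

definition low_label :: "nat \<Rightarrow> (nat \<Rightarrow> nat) \<Rightarrow> nat" where
  "low_label n \<pi> = card {q \<in> active n \<pi>. q \<le> \<pi> n}"

definition high_label :: "nat \<Rightarrow> (nat \<Rightarrow> nat) \<Rightarrow> nat" where
  "high_label n \<pi> = card {q \<in> active n \<pi>. \<pi> n < q}"

lemma labels_append_below:
  assumes perm: "\<pi> permutes {1..n}" and n: "1 \<le> n" and p: "p \<in> active n \<pi>" and below: "p \<le> \<pi> n"
  shows "low_label (Suc n) (append_value n p \<pi>) = card {q \<in> active n \<pi>. q \<le> p}"
    and "high_label (Suc n) (append_value n p \<pi>) = Suc (high_label n \<pi>)"
proof -
  note act = active_append_below[OF assms]
  have "{q \<in> active (Suc n) (append_value n p \<pi>). q \<le> p} = {q \<in> active n \<pi>. q \<le> p}"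
    using below unfolding act by auto
  then show "low_label (Suc n) (append_value n p \<pi>) = card {q \<in> active n \<pi>. q \<le> p}"
    by (simp add: low_label_def)
  have "{q \<in> active (Suc n) (append_value n p \<pi>). p < q} =
      insert (Suc p) (Suc ` {q \<in> active n \<pi>. \<pi> n < q})"
    using below unfolding act by auto
  moreover have "Suc p \<notin> Suc ` {q \<in> active n \<pi>. \<pi> n < q}" using below by auto
  ultimately show "high_label (Suc n) (append_value n p \<pi>) = Suc (high_label n \<pi>)"
    by (simp add: high_label_def card_image)
qed

lemma labels_append_above:
  assumes n: "1 \<le> n" and p: "p \<in> active n \<pi>" and above: "\<pi> n < p"
  defines "r \<equiv> card {q \<in> active n \<pi>. \<pi> n < q \<and> q \<le> p}"
  shows "low_label (Suc n) (append_value n p \<pi>) = low_label n \<pi> + r"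
    and "high_label (Suc n) (append_value n p \<pi>) = Suc (high_label n \<pi>) - r"
proof -
  note act = active_append_above[OF n p above]
  have "{q \<in> active (Suc n) (append_value n p \<pi>). q \<le> p} =
      {q \<in> active n \<pi>. q \<le> \<pi> n} \<union> {q \<in> active n \<pi>. \<pi> n < q \<and> q \<le> p}"
    using above unfolding act by auto
  moreover have "card \<dots> = low_label n \<pi> + r"
    unfolding low_label_def r_def by (intro card_Un_disjoint) auto
  ultimately show "low_label (Suc n) (append_value n p \<pi>) = low_label n \<pi> + r"
    by (simp add: low_label_def)
  have "{q \<in> active (Suc n) (append_value n p \<pi>). p < q} = Suc ` {q \<in> active n \<pi>. p \<le> q}"
    unfolding act by auto
  then have 1: "high_label (Suc n) (append_value n p \<pi>) = card {q \<in> active n \<pi>. p \<le> q}"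
    by (simp add: high_label_def card_image)
  have "insert p {q \<in> active n \<pi>. p < q} = {q \<in> active n \<pi>. p \<le> q}" using p by auto
  then have 2: "card {q \<in> active n \<pi>. p \<le> q} = Suc (card {q \<in> active n \<pi>. p < q})"
    using card_insert_disjoint[of "{q \<in> active n \<pi>. p < q}" p] by simp
  have "{q \<in> active n \<pi>. \<pi> n < q} =
      {q \<in> active n \<pi>. \<pi> n < q \<and> q \<le> p} \<union> {q \<in> active n \<pi>. p < q}"
    using above by auto
  moreover have "card \<dots> = r + card {q \<in> active n \<pi>. p < q}"
    unfolding r_def by (intro card_Un_disjoint) auto
  ultimately show "high_label (Suc n) (append_value n p \<pi>) = Suc (high_label n \<pi>) - r"
    using 1 2 by (simp add: high_label_def)
qed

text \<open>
  The label of a child depends on the inserted site only through its rank among the sites, so the sum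
  over the sites becomes a sum over an interval of ranks.
\<close>

lemma sum_by_rank:
  fixes A :: "nat set" and f :: "nat \<Rightarrow> 'a :: comm_monoid_add"
  assumes "finite A"
  shows "(\<Sum>p\<in>A. f (card {q \<in> A. q \<le> p})) = (\<Sum>i=1..card A. f i)"
  using assms
proof (induction A rule: finite_linorder_max_induct)
  case (insert m A)
  have "{q \<in> insert m A. q \<le> m} = insert m A" using insert.hyps by auto
  moreover have "{q \<in> insert m A. q \<le> p} = {q \<in> A. q \<le> p}" if "p \<in> A" for p
    using that insert.hyps by auto
  moreover have "m \<notin> A" using insert.hyps by auto
  ultimately show ?case using insert by (simp add: add.commute)
qed simp

text \<open>
  The commutative ring is left open because the polynomial is evaluated at power series below.
\<close>

definition label_poly :: "nat \<Rightarrow> 'a \<Rightarrow> 'a \<Rightarrow> 'a :: comm_ring_1" where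
  "label_poly n y z = (\<Sum>\<pi> | semi_baxter n \<pi>. y ^ low_label n \<pi> * z ^ high_label n \<pi>)"

lemma finite_semi_baxter [simp]: "finite {\<pi>. semi_baxter n \<pi>}"
  by (rule finite_subset[OF _ finite_permutations[of "{1..n}"]]) (auto simp: semi_baxter_def)

lemma sum_semi_baxter_Suc:
  fixes F :: "(nat \<Rightarrow> nat) \<Rightarrow> 'a :: comm_monoid_add"
  shows "(\<Sum>\<sigma> | semi_baxter (Suc n) \<sigma>. F \<sigma>) =
     (\<Sum>\<pi> | semi_baxter n \<pi>. \<Sum>p\<in>active n \<pi>. F (append_value n p \<pi>))"
proof -
  let ?f = "\<lambda>(\<pi>, p). append_value n p \<pi>"
  let ?A = "Sigma {\<pi>. semi_baxter n \<pi>} (active n)"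
  have dom: "x \<in> ?A \<longleftrightarrow> x \<in> {\<pi>. \<pi> permutes {1..n}} \<times> {1..Suc n} \<and> semi_baxter (Suc n) (?f x)" for x
    using semi_baxter_append_value[of "fst x" n "snd x"] active_subset[of "snd x" n "fst x"]
    by (cases x) (auto simp: semi_baxter_def)
  have "bij_betw ?f ?A {\<sigma>. semi_baxter (Suc n) \<sigma>}"
  proof (rule bij_betw_subset[OF append_value_bij])
    show "?A \<subseteq> {\<pi>. \<pi> permutes {1..n}} \<times> {1..Suc n}" using dom by blast
    show "?f ` ?A = {\<sigma>. semi_baxter (Suc n) \<sigma>}"
    proof (intro equalityI subsetI)
      fix \<sigma> assume "\<sigma> \<in> {\<sigma>. semi_baxter (Suc n) \<sigma>}"
      then have s: "semi_baxter (Suc n) \<sigma>" by simp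
      then have "\<sigma> \<in> {\<sigma>. \<sigma> permutes {1..Suc n}}" by (simp add: semi_baxter_def)
      then obtain x where "x \<in> {\<pi>. \<pi> permutes {1..n}} \<times> {1..Suc n}" "?f x = \<sigma>"
        using append_value_bij unfolding bij_betw_def by (metis (no_types, lifting) imageE)
      with s dom show "\<sigma> \<in> ?f ` ?A" by blast
    next
      fix \<sigma> assume "\<sigma> \<in> ?f ` ?A"
      then show "\<sigma> \<in> {\<sigma>. semi_baxter (Suc n) \<sigma>}" using dom by blast
    qed
  qed
  from sum.reindex_bij_betw[OF this, of F] show ?thesis
    by (simp add: sum.Sigma split_def)
qed

text \<open>
  The two families of children contribute two geometric sums, in \<open>y\<close> and in \<open>y / z\<close>. The factors
  \<open>1 - y\<close> and \<open>z - y\<close> clear their denominators, so that the identity holds in every commutative ring and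
  for all \<open>y\<close> and \<open>z\<close>.
\<close>

lemma label_poly_Suc:
  fixes y z :: "'a :: comm_ring_1"
  assumes n: "1 \<le> n"
  shows "(1 - y) * (z - y) * label_poly (Suc n) y z =
     y * z * ((z - y) * (label_poly n 1 z - label_poly n y z) +
              (1 - y) * (label_poly n y z - label_poly n y y))"
proof -
  let ?h = "low_label n" and ?k = "high_label n"
  have children: "(\<Sum>p\<in>active n \<pi>. y ^ low_label (Suc n) (append_value n p \<pi>) *
                          z ^ high_label (Suc n) (append_value n p \<pi>)) =
      (\<Sum>i=1..?h \<pi>. y ^ i * z ^ Suc (?k \<pi>)) + (\<Sum>i=1..?k \<pi>. y ^ (?h \<pi> + i) * z ^ (Suc (?k \<pi>) - i))"
    (is "sum ?F _ = _")
    if "semi_baxter n \<pi>" for \<pi>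
  proof -
    have perm: "\<pi> permutes {1..n}" using that by (simp add: semi_baxter_def)
    let ?L = "{q \<in> active n \<pi>. q \<le> \<pi> n}" and ?H = "{q \<in> active n \<pi>. \<pi> n < q}"
    have "sum ?F (active n \<pi>) = sum ?F (?L \<union> ?H)"
      by (rule arg_cong[where f = "sum ?F"]) auto
    also have "\<dots> = sum ?F ?L + sum ?F ?H"
      by (rule sum.union_disjoint) auto
    also have "sum ?F ?L = (\<Sum>p\<in>?L. y ^ card {q \<in> ?L. q \<le> p} * z ^ Suc (?k \<pi>))"
    proof (rule sum.cong[OF refl])
      fix p assume "p \<in> ?L"
      then have p: "p \<in> active n \<pi>" "p \<le> \<pi> n" by auto
      then have "{q \<in> ?L. q \<le> p} = {q \<in> active n \<pi>. q \<le> p}" by auto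
      then show "?F p = y ^ card {q \<in> ?L. q \<le> p} * z ^ Suc (?k \<pi>)"
        by (simp only: labels_append_below[OF perm n p])
    qed
    also have "\<dots> = (\<Sum>i=1..?h \<pi>. y ^ i * z ^ Suc (?k \<pi>))"
      using sum_by_rank[of ?L "\<lambda>i. y ^ i * z ^ Suc (?k \<pi>)"] by (simp add: low_label_def)
    also have "sum ?F ?H = (\<Sum>p\<in>?H. y ^ (?h \<pi> + card {q \<in> ?H. q \<le> p}) *
                                   z ^ (Suc (?k \<pi>) - card {q \<in> ?H. q \<le> p}))"
    proof (rule sum.cong[OF refl])
      fix p assume "p \<in> ?H"
      then have p: "p \<in> active n \<pi>" "\<pi> n < p" by auto
      have "{q \<in> ?H. q \<le> p} = {q \<in> active n \<pi>. \<pi> n < q \<and> q \<le> p}" by auto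
      then show "?F p = y ^ (?h \<pi> + card {q \<in> ?H. q \<le> p}) * z ^ (Suc (?k \<pi>) - card {q \<in> ?H. q \<le> p})"
        by (simp only: labels_append_above[OF n p])
    qed
    also have "\<dots> = (\<Sum>i=1..?k \<pi>. y ^ (?h \<pi> + i) * z ^ (Suc (?k \<pi>) - i))"
      using sum_by_rank[of ?H "\<lambda>i. y ^ (?h \<pi> + i) * z ^ (Suc (?k \<pi>) - i)"]
      by (simp add: high_label_def)
    finally show ?thesis .
  qed
  have geo1: "(1 - y) * (\<Sum>i=1..h. y ^ i * z ^ Suc k) = y * z * z ^ k * (1 - y ^ h)" for h k
  proof (induction h)
    case (Suc h)
    have "(1 - y) * (\<Sum>i=1..Suc h. y ^ i * z ^ Suc k) =
        (1 - y) * (\<Sum>i=1..h. y ^ i * z ^ Suc k) + (1 - y) * (y ^ Suc h * z ^ Suc k)"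
      by (simp add: algebra_simps)
    also have "\<dots> = y * z * z ^ k * (1 - y ^ Suc h)"
      unfolding Suc by (simp add: algebra_simps)
    finally show ?case .
  qed simp
  have geo2: "(z - y) * (\<Sum>i=1..k. y ^ (h + i) * z ^ (Suc k - i)) = y * z * y ^ h * (z ^ k - y ^ k)"
    for h k
  proof (induction k)
    case (Suc k)
    have "(\<Sum>i=1..k. y ^ (h + i) * z ^ (Suc (Suc k) - i)) = z * (\<Sum>i=1..k. y ^ (h + i) * z ^ (Suc k - i))"
      unfolding sum_distrib_left by (intro sum.cong refl) (simp add: Suc_diff_le algebra_simps)
    then have "(z - y) * (\<Sum>i=1..Suc k. y ^ (h + i) * z ^ (Suc (Suc k) - i)) =
        z * ((z - y) * (\<Sum>i=1..k. y ^ (h + i) * z ^ (Suc k - i))) + (z - y) * (y ^ (h + Suc k) * z)"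
      by (simp add: algebra_simps)
    then show ?case unfolding Suc by (simp add: algebra_simps power_add)
  qed simp
  have summand: "(1 - y) * (z - y) * ((\<Sum>i=1..h. y ^ i * z ^ Suc k) +
                (\<Sum>i=1..k. y ^ (h + i) * z ^ (Suc k - i))) =
      y * z * ((z - y) * (1 ^ h * z ^ k - y ^ h * z ^ k) + (1 - y) * (y ^ h * z ^ k - y ^ h * y ^ k))"
    (is "_ * (?a + ?b) = _") for h k
  proof -
    have "(1 - y) * (z - y) * (?a + ?b) = (z - y) * ((1 - y) * ?a) + (1 - y) * ((z - y) * ?b)"
      by (simp add: algebra_simps)
    also have "\<dots> = y * z * ((z - y) * (1 ^ h * z ^ k - y ^ h * z ^ k) + (1 - y) * (y ^ h * z ^ k - y ^ h * y ^ k))"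
      unfolding geo1 geo2 by (simp add: algebra_simps)
    finally show ?thesis .
  qed
  have "(1 - y) * (z - y) * label_poly (Suc n) y z =
      (\<Sum>\<pi> | semi_baxter n \<pi>. (1 - y) * (z - y) * ((\<Sum>i=1..?h \<pi>. y ^ i * z ^ Suc (?k \<pi>)) +
          (\<Sum>i=1..?k \<pi>. y ^ (?h \<pi> + i) * z ^ (Suc (?k \<pi>) - i))))"
    unfolding label_poly_def sum_semi_baxter_Suc sum_distrib_left[symmetric]
    by (intro arg_cong[where f = "\<lambda>x. (1 - y) * (z - y) * x"] sum.cong refl children) simp
  also have "\<dots> = y * z * ((z - y) * (label_poly n 1 z - label_poly n y z) +
              (1 - y) * (label_poly n y z - label_poly n y y))"
    unfolding summand label_poly_def
    by (simp only: sum_distrib_left sum.distrib sum_subtractf distrib_left right_diff_distrib)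
  finally show ?thesis .
qed

lemma semi_baxter_1: "{\<pi>. semi_baxter 1 \<pi>} = {id}"
  by (auto simp: semi_baxter_def permutes_sing permutes_id)

lemma label_poly_1: "label_poly 1 y z = y * z"
proof -
  have "active 1 id = {1, 2}" by (auto simp: active_def)
  then have "{q \<in> active 1 id. q \<le> id 1} = {1}" "{q \<in> active 1 id. id 1 < q} = {2}" by auto
  then show ?thesis
    by (simp add: label_poly_def semi_baxter_1[simplified] low_label_def high_label_def)
qed

section \<open>Generating series in a parameter, and Lagrange inversion\<close>

unbundle fps_syntax

text \<open>
  The sum of \<open>X\<^sup>i s\<^sub>i\<close> over all \<open>i\<close>. As \<open>X\<close> has no constant term, the terms with \<open>i > n\<close> do not contribute to
  the \<open>n\<close>-th coefficient, which makes the truncated sum the right one. For constant \<open>s\<^sub>i\<close> this is composition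
  of power series; in general it is the value at \<open>x = X\<close> of a series in \<open>x\<close> whose coefficients
  themselves depend on the parameter.
\<close>

definition fps_sum_powers :: "'a :: comm_ring_1 fps \<Rightarrow> (nat \<Rightarrow> 'a fps) \<Rightarrow> 'a fps" where
  "fps_sum_powers X s = Abs_fps (\<lambda>n. \<Sum>i\<le>n. (X ^ i * s i) $ n)"

lemma fps_power_mult_nth_eq_0:
  fixes X :: "'a :: comm_ring_1 fps"
  assumes "X $ 0 = 0" and "n < k"
  shows "(X ^ k * f) $ n = 0"
  using startsby_zero_power_prefix[OF assms(1), of k] assms(2) by (auto simp: fps_mult_nth intro!: sum.neutral)

lemma fps_sum_powers_nth:
  assumes "X $ 0 = 0" and "n \<le> N"
  shows "fps_sum_powers X s $ n = (\<Sum>i\<le>N. (X ^ i * s i) $ n)"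
  unfolding fps_sum_powers_def fps_nth_Abs_fps
  using assms by (intro sum.mono_neutral_left) (auto simp: fps_power_mult_nth_eq_0)

lemma fps_sum_powers_add:
  "fps_sum_powers X (\<lambda>i. s i + t i) = fps_sum_powers X s + fps_sum_powers X t"
  by (simp add: fps_eq_iff fps_sum_powers_def distrib_left sum.distrib)

lemma fps_sum_powers_diff:
  "fps_sum_powers X (\<lambda>i. s i - t i) = fps_sum_powers X s - fps_sum_powers X t"
  by (simp add: fps_eq_iff fps_sum_powers_def right_diff_distrib sum_subtractf)

lemma fps_sum_powers_mult_left:
  assumes "X $ 0 = 0"
  shows "fps_sum_powers X (\<lambda>i. f * s i) = f * fps_sum_powers X s"
proof (rule fps_ext)
  fix n
  have "(f * fps_sum_powers X s) $ n = (\<Sum>j=0..n. \<Sum>i\<le>n. f $ j * (X ^ i * s i) $ (n - j))"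
    by (simp add: fps_mult_nth fps_sum_powers_nth[OF assms, where N = n] sum_distrib_left del: fps_mult_nth_0)
  also have "\<dots> = (\<Sum>i\<le>n. (f * (X ^ i * s i)) $ n)"
    by (subst sum.swap) (simp add: fps_mult_nth)
  finally show "fps_sum_powers X (\<lambda>i. f * s i) $ n = (f * fps_sum_powers X s) $ n"
    by (simp add: fps_sum_powers_def mult.left_commute)
qed

lemma fps_sum_powers_unfold:
  assumes "X $ 0 = 0"
  shows "fps_sum_powers X s = s 0 + X * fps_sum_powers X (\<lambda>i. s (Suc i))"
proof (rule fps_ext)
  fix n
  have "(X * fps_sum_powers X (\<lambda>i. s (Suc i))) $ n = (\<Sum>i\<le>n. (X ^ Suc i * s (Suc i)) $ n)"
    unfolding fps_sum_powers_mult_left[OF assms, symmetric]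
    by (simp add: fps_sum_powers_def mult.assoc mult.left_commute)
  then have "(s 0 + X * fps_sum_powers X (\<lambda>i. s (Suc i))) $ n = (\<Sum>i\<le>Suc n. (X ^ i * s i) $ n)"
    by (simp only: sum.atMost_Suc_shift fps_add_nth power_0 mult_1_left)
  then show "fps_sum_powers X s $ n = (s 0 + X * fps_sum_powers X (\<lambda>i. s (Suc i))) $ n"
    using fps_sum_powers_nth[OF assms, of n "Suc n" s] by simp
qed

lemma fps_sum_powers_const:
  "fps_sum_powers X (\<lambda>i. fps_const (c i)) = Abs_fps c oo X"
  by (simp add: fps_eq_iff fps_sum_powers_def fps_compose_nth atMost_atLeast0 mult.commute[of "X ^ _"])

text \<open>
  With \<open>X = w / \<phi>(w)\<close>, the product \<open>X\<^sup>k X' \<phi>\<^sup>n\<close> has \<open>w\<^sup>n\<^sup>-\<^sup>1\<close>-coefficient \<open>1\<close> for \<open>k = n - 1\<close> and \<open>0\<close> for smaller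
  \<open>k\<close>, because \<open>X\<^sup>k X' / X\<^sup>n\<close> is a derivative, hence without residue, unless \<open>k = n - 1\<close>. So multiplying
  the derivative of \<open>Q(X)\<close> by \<open>\<phi>\<^sup>n\<close> isolates the coefficient of \<open>Q\<close>.
\<close>

lemma lagrange_inversion:
  fixes Q X \<phi> :: "'a :: field_char_0 fps"
  assumes X0: "X $ 0 = 0" and X: "X * \<phi> = fps_X" and n: "1 \<le> n"
  shows "of_nat n * Q $ n = (fps_deriv (Q oo X) * \<phi> ^ n) $ (n - 1)"
proof -
  have "fps_deriv (X * \<phi>) = 1" by (simp add: X)
  then have dX: "fps_deriv X * \<phi> = 1 - X * fps_deriv \<phi>" by (simp add: algebra_simps)
  have basis: "(X ^ k * (fps_deriv X * \<phi> ^ n)) $ (n - 1) = (if k = n - 1 then 1 else 0)" if "k \<le> n - 1" for k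
  proof -
    define r where "r = n - 1 - k"
    have nk: "n = Suc (k + r)" using that n by (simp add: r_def)
    have "X ^ k * (fps_deriv X * \<phi> ^ n) = (X * \<phi>) ^ k * (\<phi> ^ r * (fps_deriv X * \<phi>))"
      unfolding nk by (simp add: power_add power_mult_distrib algebra_simps)
    also have "\<dots> = fps_X ^ k * (\<phi> ^ r * (1 - X * fps_deriv \<phi>))" unfolding dX X ..
    finally have "(X ^ k * (fps_deriv X * \<phi> ^ n)) $ (n - 1) = (\<phi> ^ r * (1 - X * fps_deriv \<phi>)) $ r"
      by (simp add: fps_X_power_mult_nth nk)
    also have "\<dots> = (if r = 0 then 1 else 0)"
    proof (cases r)
      case (Suc q)
      \<comment> \<open>This is \<open>\<phi>\<^sup>r - w (\<phi>\<^sup>r)' / r\<close>, whose coefficient at \<open>w\<^sup>r\<close> cancels.\<close>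
      have "\<phi> ^ r * (1 - X * fps_deriv \<phi>) = \<phi> ^ r - (X * \<phi>) * (\<phi> ^ q * fps_deriv \<phi>)"
        by (simp add: Suc algebra_simps)
      also have "(X * \<phi>) * (\<phi> ^ q * fps_deriv \<phi>) = fps_X * (\<phi> ^ q * fps_deriv \<phi>)" by (simp add: X)
      finally have "(\<phi> ^ r * (1 - X * fps_deriv \<phi>)) $ r = \<phi> ^ r $ r - (\<phi> ^ q * fps_deriv \<phi>) $ q"
        by (simp add: Suc)
      moreover have "fps_deriv (\<phi> ^ r) $ q = of_nat r * (\<phi> ^ q * fps_deriv \<phi>) $ q"
        by (simp only: fps_deriv_power Suc diff_Suc_1 mult.assoc fps_mult_left_const_nth mult.commute[of "\<phi> ^ q"])
      moreover have "fps_deriv (\<phi> ^ r) $ q = of_nat r * \<phi> ^ r $ r"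
        by (simp only: fps_deriv_nth Suc Suc_eq_plus1)
      moreover have "of_nat r \<noteq> (0 :: 'a)" by (simp add: Suc del: of_nat_Suc)
      ultimately show ?thesis by (simp only: Suc mult_cancel_left) simp
    qed (simp add: X0)
    finally show ?thesis using that by (auto simp: r_def)
  qed
  have "fps_deriv (Q oo X) * \<phi> ^ n = (fps_deriv X * \<phi> ^ n) * (fps_deriv Q oo X)"
    by (simp add: fps_compose_deriv[OF X0] algebra_simps)
  also have "fps_deriv Q oo X = fps_sum_powers X (\<lambda>i. fps_const (fps_deriv Q $ i))"
    by (simp only: fps_sum_powers_const fps_nth_inverse)
  also have "(fps_deriv X * \<phi> ^ n) * \<dots> =
      fps_sum_powers X (\<lambda>i. (fps_deriv X * \<phi> ^ n) * fps_const (fps_deriv Q $ i))"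
    by (rule fps_sum_powers_mult_left[OF X0, symmetric])
  also have "\<dots> $ (n - 1) = (\<Sum>i\<le>n - 1. fps_deriv Q $ i * (X ^ i * (fps_deriv X * \<phi> ^ n)) $ (n - 1))"
    unfolding fps_sum_powers_def fps_nth_Abs_fps
    by (intro sum.cong refl)
       (simp only: mult.assoc[symmetric] fps_mult_right_const_nth, simp only: mult.commute)
  also have "\<dots> = (\<Sum>i\<le>n - 1. if i = n - 1 then fps_deriv Q $ i else 0)"
    by (intro sum.cong refl) (subst basis, simp_all)
  also have "\<dots> = of_nat n * Q $ n" using n by simp
  finally show ?thesis by simp
qed

section \<open>The kernel method along an orbit\<close>

lemma label_poly_fps_const: "label_poly n (fps_const y) (fps_const z) = fps_const (label_poly n y z)"
  by (simp add: label_poly_def fps_eq_iff fps_sum_nth flip: fps_const_mult)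

text \<open>
  On the kernel curve the coefficient of the full generating function \<open>T Y Z\<close> is zero, which leaves a
  relation between its two specialisations.
\<close>

lemma kernel_equation:
  fixes X Y Z :: "'a :: field fps"
  defines "T \<equiv> \<lambda>Y Z. fps_sum_powers X (\<lambda>n. label_poly (Suc n) Y Z)"
  assumes X0: "X $ 0 = 0" and kernel: "(1 - Y) * (Z - Y) + X * Y * Z * (Z - 1) = 0"
    and nz: "Y \<noteq> 0" "Z \<noteq> 0"
  shows "(1 - Y) * (Z - Y) + X * ((Z - Y) * T 1 Z - (1 - Y) * T Y Y) = 0"
proof -
  let ?D = "(1 - Y) * (Z - Y)"
  let ?R = "\<lambda>n. Y * Z * ((Z - Y) * (label_poly n 1 Z - label_poly n Y Z) +
                        (1 - Y) * (label_poly n Y Z - label_poly n Y Y))"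
  have "?D * T Y Z = ?D * (Y * Z) + X * (?D * fps_sum_powers X (\<lambda>n. label_poly (Suc (Suc n)) Y Z))"
    unfolding T_def
    by (subst fps_sum_powers_unfold[OF X0])
       (simp only: One_nat_def[symmetric] label_poly_1 distrib_left mult.left_commute)
  also have "?D * fps_sum_powers X (\<lambda>n. label_poly (Suc (Suc n)) Y Z) = fps_sum_powers X (\<lambda>n. ?R (Suc n))"
    unfolding fps_sum_powers_mult_left[OF X0, symmetric]
    by (rule arg_cong[where f = "fps_sum_powers X"], rule ext, rule label_poly_Suc) simp
  also have "\<dots> = Y * Z * ((Z - Y) * (T 1 Z - T Y Z) + (1 - Y) * (T Y Z - T Y Y))"
    unfolding T_def by (simp only: fps_sum_powers_mult_left[OF X0] fps_sum_powers_add fps_sum_powers_diff)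
  finally have "?D * T Y Z = ?D * (Y * Z) + X * \<dots>" .
  then have "(Y * Z) * (?D + X * ((Z - Y) * T 1 Z - (1 - Y) * T Y Y)) = (?D + X * Y * Z * (Z - 1)) * T Y Z"
    by (simp add: algebra_simps)
  then show ?thesis using kernel nz by simp
qed

text \<open>
  The five relations hold at the pairs \<open>(a, z)\<close>, \<open>(a\<^sub>2, z)\<close>, \<open>(a\<^sub>2, z\<^sub>2)\<close>, \<open>(a\<^sub>3, z\<^sub>2)\<close>, \<open>(a\<^sub>3, z\<^sub>3)\<close>, where
  \<open>z = 1 + a + w\<close>, \<open>a\<^sub>2 = w / (1 + a)\<close>, \<open>z\<^sub>2 = 1 + w / a\<close>, \<open>a\<^sub>3 = w / (a z)\<close> and \<open>z\<^sub>3 = 1 + 1 / a\<close>. Each of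
  them expresses one unknown by the next, and the chain ends at the value \<open>A3\<close> at \<open>z\<^sub>3\<close>. The inverses
  \<open>\<beta> = 1 / a\<close>, \<open>\<gamma> = 1 / (1 + a)\<close>, \<open>u = 1 / z\<close> and \<open>v = 1 / (a + w)\<close> are variables of their own, so that
  the elimination is polynomial arithmetic in an integral domain.
\<close>

lemma orbit_elimination:
  fixes w \<alpha> \<beta> \<gamma> u v X A1 A2 A3 B1 B2 B3 :: "'a :: idom"
  assumes inv: "\<alpha> * \<beta> = 1" "(1 + \<alpha>) * \<gamma> = 1" "(1 + \<alpha> + w) * u = 1" "(\<alpha> + w) * v = 1"
    and X: "X = \<alpha> * \<gamma> * u * v * w" and w: "w \<noteq> 0"
    and E1: "- \<alpha> * w + X * (w * A1 + \<alpha> * B1) = 0"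
    and E2: "- (\<gamma> * w) * (\<alpha> + w - \<gamma> * w) + X * ((\<alpha> + w - \<gamma> * w) * A1 + \<gamma> * w * B2) = 0"
    and E3: "- (\<gamma> * w) * (\<beta> * w - \<gamma> * w) + X * ((\<beta> * w - \<gamma> * w) * A2 + \<gamma> * w * B2) = 0"
    and E4: "- (\<beta> * w * u) * (\<beta> * w - \<beta> * w * u) + X * ((\<beta> * w - \<beta> * w * u) * A2 + \<beta> * w * u * B3) = 0"
    and E5: "- (\<beta> * w * u) * (\<beta> - \<beta> * w * u) + X * ((\<beta> - \<beta> * w * u) * A3 + \<beta> * w * u * B3) = 0"
  shows "B1 + (1 + \<alpha>)\<^sup>2 * \<beta> ^ 4 * (X * A3) =
     (1 + \<alpha>) * \<beta> * (1 + \<alpha> + w) * (\<alpha> + w) - \<beta>\<^sup>2 * w * (1 + \<alpha> + w) * (\<alpha> + w)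
     + \<beta> ^ 4 * w\<^sup>2 * (\<alpha> + w) + \<beta> ^ 5 * w * (1 - w) * (1 + \<alpha>)"
proof -
  have R1: "X * B1 = w - \<beta> * w * (X * A1)"
    using E1 inv(1) by algebra
  have R2: "X * A1 = \<gamma> * w - \<beta> * u * w * (X * B2)"
    using E2 inv by algebra
  \<comment> \<open>Both coefficients of E3 are multiples of \<open>\<gamma> w\<close>, those of E4 of \<open>\<beta> w u\<close> and those of E5 of \<open>\<beta> u\<close>.\<close>
  have "\<beta> * w - \<gamma> * w = \<beta> * \<gamma> * w"
    using inv by algebra
  then have "\<gamma> * w * (X * B2 - (\<beta> * \<gamma> * w - \<beta> * (X * A2))) = 0"
    using E3 by algebra
  moreover have "\<gamma> \<noteq> 0" "\<beta> \<noteq> 0" "u \<noteq> 0" "\<alpha> \<noteq> 0" "v \<noteq> 0" using inv by auto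
  ultimately have R3: "X * B2 = \<beta> * \<gamma> * w - \<beta> * (X * A2)"
    using w by simp
  have "\<beta> * w * u * (X * A2 - (\<beta> * w * u - v * (X * B3))) = 0"
    using E4 inv by algebra
  then have R4: "X * A2 = \<beta> * w * u - v * (X * B3)"
    using w \<open>\<beta> \<noteq> 0\<close> \<open>u \<noteq> 0\<close> by simp
  have "\<beta> * u * (w * (X * B3) - ((1 + \<alpha>) * \<beta> * w * u - (1 + \<alpha>) * (X * A3))) = 0"
    using E5 inv by algebra
  then have R5: "w * (X * B3) = (1 + \<alpha>) * \<beta> * w * u - (1 + \<alpha>) * (X * A3)"
    using \<open>\<beta> \<noteq> 0\<close> \<open>u \<noteq> 0\<close> by simp
  have "X * B1 = w - \<beta> * \<gamma> * w\<^sup>2 + \<beta> ^ 3 * \<gamma> * u * w ^ 3 - \<beta> ^ 4 * u\<^sup>2 * w ^ 3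
      + \<beta> ^ 3 * u * v * w * (w * (X * B3))"
    unfolding R1 R2 R3 R4 by algebra
  then have XB: "X * B1 = w - \<beta> * \<gamma> * w\<^sup>2 + \<beta> ^ 3 * \<gamma> * u * w ^ 3 - \<beta> ^ 4 * u\<^sup>2 * w ^ 3
      + \<beta> ^ 3 * u * v * w * ((1 + \<alpha>) * \<beta> * w * u - (1 + \<alpha>) * (X * A3))"
    unfolding R5 .
  let ?P = "(1 + \<alpha>) * \<beta> * (1 + \<alpha> + w) * (\<alpha> + w) - \<beta>\<^sup>2 * w * (1 + \<alpha> + w) * (\<alpha> + w)
     + \<beta> ^ 4 * w\<^sup>2 * (\<alpha> + w) + \<beta> ^ 5 * w * (1 - w) * (1 + \<alpha>)"
  \<comment> \<open>The coefficient of A3 collected along the chain is again a multiple of X.\<close>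
  have G: "X * ((1 + \<alpha>)\<^sup>2 * \<beta> ^ 4) = \<beta> ^ 3 * u * v * w * (1 + \<alpha>)"
    unfolding X using inv by algebra
  have P: "X * ?P = w - \<beta> * \<gamma> * w\<^sup>2 + \<beta> ^ 3 * \<gamma> * u * w ^ 3 - \<beta> ^ 4 * u\<^sup>2 * w ^ 3
      + \<beta> ^ 3 * u * v * w * ((1 + \<alpha>) * \<beta> * w * u)"
    unfolding X using inv by algebra
  have "X * (B1 + (1 + \<alpha>)\<^sup>2 * \<beta> ^ 4 * (X * A3)) = X * B1 + X * ((1 + \<alpha>)\<^sup>2 * \<beta> ^ 4) * (X * A3)"
    by (simp only: distrib_left mult.assoc)
  also have "\<dots> = X * ?P"
    unfolding XB G P by (simp add: algebra_simps)
  finally have "X * (B1 + (1 + \<alpha>)\<^sup>2 * \<beta> ^ 4 * (X * A3)) = X * ?P" .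
  moreover have "X \<noteq> 0" unfolding X using w \<open>\<gamma> \<noteq> 0\<close> \<open>u \<noteq> 0\<close> \<open>\<alpha> \<noteq> 0\<close> \<open>v \<noteq> 0\<close> by simp
  ultimately show ?thesis by simp
qed

text \<open>
  The result of the elimination, ordered by powers of the parameter \<open>w\<close>.
\<close>

definition orbit_sum_series :: "real \<Rightarrow> real fps" where
  "orbit_sum_series a =
     fps_const ((1 + a)\<^sup>2)
     + fps_const ((1 + a) * (2 + 1 / a ^ 5)) * fps_X
     + fps_const (1 - 1 / a - 1 / a ^ 2 + 1 / a ^ 3 - 1 / a ^ 4 - 1 / a ^ 5) * fps_X ^ 2
     + fps_const (1 / a ^ 4 - 1 / a ^ 2) * fps_X ^ 3"

text \<open>
  The variable \<open>a\<close> is a fixed positive real number here, so the series have real coefficients and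
  \<open>1 + 1/a\<close> is an ordinary number; it becomes an indeterminate again when constant terms are taken.
\<close>

lemma label_poly_lagrange:
  fixes a :: real
  assumes a: "0 < a" and n: "1 \<le> n"
  shows "real n * (label_poly (Suc n) (1 + a) (1 + a) + (1 + a)\<^sup>2 / a ^ 4 * label_poly n 1 (1 + 1 / a)) =
     (fps_deriv (orbit_sum_series a) *
        (fps_const ((1 + a) / a) * (fps_X + fps_const (1 + a)) * (fps_X + fps_const a)) ^ n) $ (n - 1)"
proof -
  let ?w = "fps_X :: real fps"
  define \<alpha> \<beta> \<gamma> where "\<alpha> = fps_const a" and "\<beta> = fps_const (1 / a)" and "\<gamma> = fps_const (1 / (1 + a))"
  define u v where "u = inverse (1 + \<alpha> + ?w)" and "v = inverse (\<alpha> + ?w)"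
  define X where "X = \<alpha> * \<gamma> * u * v * ?w"
  define T where "T = (\<lambda>Y Z. fps_sum_powers X (\<lambda>n. label_poly (Suc n) Y Z))"
  have one: "1 = fps_const (1 :: real)" by simp
  have inv: "\<alpha> * \<beta> = 1" "(1 + \<alpha>) * \<gamma> = 1" "(1 + \<alpha> + ?w) * u = 1" "(\<alpha> + ?w) * v = 1"
    using a by (simp_all add: \<alpha>_def \<beta>_def \<gamma>_def u_def v_def one inverse_mult_eq_1' del: fps_const_1_eq_1)
  have X0: "X $ 0 = 0" by (simp add: X_def)
  have nth0: "\<alpha> $ 0 = a" "\<beta> $ 0 = 1 / a" "\<gamma> $ 0 = 1 / (1 + a)"
    by (simp_all add: \<alpha>_def \<beta>_def \<gamma>_def)
  have E: "(1 - Y) * (Z - Y) + X * ((Z - Y) * T 1 Z - (1 - Y) * T Y Y) = 0"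
    if "(1 - Y) * (Z - Y) + X * Y * Z * (Z - 1) = 0" "Y $ 0 \<noteq> 0" "Z $ 0 \<noteq> 0" for Y Z
    unfolding T_def by (rule kernel_equation[OF X0 that(1)]) (use that in auto)
  let ?Y1 = "1 + \<alpha>" and ?Y2 = "1 + \<gamma> * ?w" and ?Y3 = "1 + \<beta> * ?w * u"
    and ?Z1 = "1 + \<alpha> + ?w" and ?Z2 = "1 + \<beta> * ?w" and ?Z3 = "1 + \<beta>"
  \<comment> \<open>The five pairs of the orbit all lie on the kernel curve.\<close>
  have E1: "(1 - ?Y1) * (?Z1 - ?Y1) + X * ((?Z1 - ?Y1) * T 1 ?Z1 - (1 - ?Y1) * T ?Y1 ?Y1) = 0"
    by (rule E) (use inv X_def in algebra, use a in \<open>simp_all add: nth0\<close>)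
  have E2: "(1 - ?Y2) * (?Z1 - ?Y2) + X * ((?Z1 - ?Y2) * T 1 ?Z1 - (1 - ?Y2) * T ?Y2 ?Y2) = 0"
    by (rule E) (use inv X_def in algebra, use a in \<open>simp_all add: nth0\<close>)
  have E3: "(1 - ?Y2) * (?Z2 - ?Y2) + X * ((?Z2 - ?Y2) * T 1 ?Z2 - (1 - ?Y2) * T ?Y2 ?Y2) = 0"
    by (rule E) (use inv X_def in algebra, use a in \<open>simp_all add: nth0\<close>)
  have E4: "(1 - ?Y3) * (?Z2 - ?Y3) + X * ((?Z2 - ?Y3) * T 1 ?Z2 - (1 - ?Y3) * T ?Y3 ?Y3) = 0"
    by (rule E) (use inv X_def in algebra, use a in \<open>simp_all add: nth0\<close>)
  have E5: "(1 - ?Y3) * (?Z3 - ?Y3) + X * ((?Z3 - ?Y3) * T 1 ?Z3 - (1 - ?Y3) * T ?Y3 ?Y3) = 0"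
    by (rule E) (use inv X_def a in algebra, use a in \<open>simp_all add: nth0 add_nonneg_eq_0_iff\<close>)
  have B: "T ?Y1 ?Y1 = Abs_fps (\<lambda>n. label_poly (Suc n) (1 + a) (1 + a)) oo X"
    by (simp add: T_def \<alpha>_def one label_poly_fps_const fps_sum_powers_const del: fps_const_1_eq_1)
  have A: "T 1 ?Z3 = Abs_fps (\<lambda>n. label_poly (Suc n) 1 (1 + 1 / a)) oo X"
    by (simp add: T_def \<beta>_def one label_poly_fps_const fps_sum_powers_const del: fps_const_1_eq_1)
  \<comment> \<open>The extra factor X in front of A shifts its coefficients by one size.\<close>
  define Q where "Q = Abs_fps (\<lambda>n. label_poly (Suc n) (1 + a) (1 + a)) +
      fps_const ((1 + a)\<^sup>2 / a ^ 4) * (?w * Abs_fps (\<lambda>n. label_poly (Suc n) 1 (1 + 1 / a)))"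
  have G: "fps_const ((1 + a)\<^sup>2 / a ^ 4) = (1 + \<alpha>)\<^sup>2 * \<beta> ^ 4"
    by (simp add: \<alpha>_def \<beta>_def one fps_const_power power_divide del: fps_const_1_eq_1)
  have "Q oo X = T ?Y1 ?Y1 + (1 + \<alpha>)\<^sup>2 * \<beta> ^ 4 * (X * T 1 ?Z3)"
    by (simp add: Q_def fps_compose_add_distrib fps_compose_mult_distrib[OF X0] X0 A B G[symmetric])
  also have "\<dots> = (1 + \<alpha>) * \<beta> * (1 + \<alpha> + ?w) * (\<alpha> + ?w) - \<beta>\<^sup>2 * ?w * (1 + \<alpha> + ?w) * (\<alpha> + ?w)
     + \<beta> ^ 4 * ?w\<^sup>2 * (\<alpha> + ?w) + \<beta> ^ 5 * ?w * (1 - ?w) * (1 + \<alpha>)"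
    by (rule orbit_elimination[OF inv X_def _ _ _ _ _ , where ?A1.0 = "T 1 ?Z1" and ?A2.0 = "T 1 ?Z2"
          and ?B2.0 = "T ?Y2 ?Y2" and ?B3.0 = "T ?Y3 ?Y3"])
       (use E1 E2 E3 E4 E5 in \<open>simp_all add: algebra_simps\<close>)
  also have "\<dots> = (1 + \<alpha>)\<^sup>2 + (1 + \<alpha>) * (2 + \<beta> ^ 5) * ?w
      + (1 - \<beta> - \<beta>\<^sup>2 + \<beta> ^ 3 - \<beta> ^ 4 - \<beta> ^ 5) * ?w\<^sup>2 + (\<beta> ^ 4 - \<beta>\<^sup>2) * ?w ^ 3"
    using inv(1) by algebra
  also have "\<dots> = orbit_sum_series a"
    by (simp add: orbit_sum_series_def \<alpha>_def \<beta>_def one fps_const_power power_divide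
        numeral_fps_const del: fps_const_1_eq_1)
  finally have QX: "Q oo X = orbit_sum_series a" .
  let ?\<phi> = "fps_const ((1 + a) / a) * (?w + fps_const (1 + a)) * (?w + fps_const a)"
  have "?\<phi> = (1 + \<alpha>) * \<beta> * (1 + \<alpha> + ?w) * (\<alpha> + ?w)"
    by (simp add: \<alpha>_def \<beta>_def one add.commute del: fps_const_1_eq_1)
  then have "X * ?\<phi> = ?w"
    unfolding X_def using inv by algebra
  from lagrange_inversion[OF X0 this n, of Q]
  have "real n * Q $ n = (fps_deriv (orbit_sum_series a) * ?\<phi> ^ n) $ (n - 1)"
    unfolding QX .
  moreover have "Q $ n = label_poly (Suc n) (1 + a) (1 + a) + (1 + a)\<^sup>2 / a ^ 4 * label_poly n 1 (1 + 1 / a)"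
    using n by (cases n) (simp_all add: Q_def)
  ultimately show ?thesis by simp
qed

section \<open>Constant terms of Laurent polynomials\<close>

text \<open>
  With the value \<open>0\<close> at negative integers, \<open>1 / k!\<close> satisfies the functional equation \<open>rfact_step\<close> at every
  integer. Binomial coefficients and telescoping certificates then need no side conditions at the ends
  of their ranges.
\<close>

definition rfact :: "int \<Rightarrow> real" where
  "rfact k = (if k < 0 then 0 else 1 / fact (nat k))"

lemma rfact_neg [simp]: "k < 0 \<Longrightarrow> rfact k = 0"
  by (simp add: rfact_def)

lemma rfact_of_nat: "rfact (int k) = 1 / fact k"
  by (simp add: rfact_def)

lemma rfact_step:
  assumes "k + 1 = l" and "c = of_int l"
  shows "rfact k = c * rfact l"
proof (cases "l \<le> 0")
  case True
  with assms show ?thesis by (auto simp: rfact_def)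
next
  case False
  then obtain n where "l = int (Suc n)" by (metis gr0_implies_Suc not_le zero_less_imp_eq_int)
  with assms show ?thesis by (auto simp: rfact_def nat_add_distrib)
qed

definition ibinom :: "nat \<Rightarrow> int \<Rightarrow> real" where
  "ibinom n k = fact n * rfact k * rfact (int n - k)"

lemma ibinom_of_nat: "ibinom n (int k) = real (n choose k)"
proof (cases "k \<le> n")
  case True
  then have "int n - int k = int (n - k)" by simp
  then show ?thesis using True by (simp only: ibinom_def rfact_of_nat) (simp add: binomial_fact)
qed (simp add: ibinom_def)

lemma ibinom_neg [simp]: "k < 0 \<Longrightarrow> ibinom n k = 0"
  by (simp add: ibinom_def)

text \<open>
  The function \<open>f\<close> is a Laurent polynomial in \<open>a > 0\<close>, with constant term \<open>c\<close>: the exponent \<open>M\<close> clears its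
  denominators.
\<close>

definition constant_term :: "(real \<Rightarrow> real) \<Rightarrow> real \<Rightarrow> bool" where
  "constant_term f c \<longleftrightarrow> (\<exists>p M. (\<forall>a>0. a ^ M * f a = poly p a) \<and> coeff p M = c)"

text \<open>
  Two representations agree at infinitely many points, hence as polynomials once brought to the same
  power of \<open>a\<close>.
\<close>

lemma constant_term_unique:
  assumes "constant_term f c" and "constant_term f d"
  shows "c = d"
proof -
  obtain p M where p: "\<forall>a>0. a ^ M * f a = poly p a" "coeff p M = c"
    using assms(1) by (auto simp: constant_term_def)
  obtain q N where q: "\<forall>a>0. a ^ N * f a = poly q a" "coeff q N = d"
    using assms(2) by (auto simp: constant_term_def)
  let ?r = "monom 1 N * p - monom 1 M * q"
  have "poly ?r a = 0" if "0 < a" for a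
    using p(1) q(1) that by (simp add: poly_monom flip: p(1) q(1))
  then have "{0<..} \<subseteq> {a. poly ?r a = 0}" by auto
  then have "\<not> finite {a. poly ?r a = 0}"
    using infinite_Ioi finite_subset by blast
  then have "?r = 0" using poly_roots_finite by blast
  then have "coeff (monom 1 N * p) (N + M) = coeff (monom 1 M * q) (N + M)" by simp
  then show ?thesis using p(2) q(2) by (simp add: coeff_monom_mult)
qed

lemma constant_term_add:
  assumes "constant_term f c" and "constant_term g d"
  shows "constant_term (\<lambda>a. f a + g a) (c + d)"
proof -
  obtain p M where p: "\<forall>a>0. a ^ M * f a = poly p a" "coeff p M = c"
    using assms(1) by (auto simp: constant_term_def)
  obtain q N where q: "\<forall>a>0. a ^ N * g a = poly q a" "coeff q N = d"
    using assms(2) by (auto simp: constant_term_def)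
  show ?thesis unfolding constant_term_def
  proof (intro exI conjI allI impI)
    show "a ^ (N + M) * (f a + g a) = poly (monom 1 N * p + monom 1 M * q) a" if "0 < a" for a
      using that by (simp add: poly_monom power_add algebra_simps flip: p(1) q(1))
    show "coeff (monom 1 N * p + monom 1 M * q) (N + M) = c + d"
      using p(2) q(2) by (simp add: coeff_monom_mult)
  qed
qed

lemma constant_term_mult_left:
  assumes "constant_term f c"
  shows "constant_term (\<lambda>a. k * f a) (k * c)"
proof -
  obtain p M where p: "\<forall>a>0. a ^ M * f a = poly p a" "coeff p M = c"
    using assms by (auto simp: constant_term_def)
  then show ?thesis unfolding constant_term_def
    by (intro exI[of _ "smult k p"] exI[of _ M]) (simp add: mult.left_commute)
qed

lemma constant_term_diff:
  assumes "constant_term f c" and "constant_term g d"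
  shows "constant_term (\<lambda>a. f a - g a) (c - d)"
  using constant_term_add[OF assms(1) constant_term_mult_left[OF assms(2), of "- 1"]] by simp

lemma constant_term_sum:
  assumes "\<And>i. i \<in> A \<Longrightarrow> constant_term (f i) (c i)"
  shows "constant_term (\<lambda>a. \<Sum>i\<in>A. f i a) (\<Sum>i\<in>A. c i)"
proof -
  have "constant_term (\<lambda>_. 0) 0"
    unfolding constant_term_def by (rule exI[of _ 0]) simp
  with assms show ?thesis
    by (induction A rule: infinite_finite_induct) (auto intro: constant_term_add)
qed

lemma constant_term_cong:
  assumes "constant_term f c" and "\<And>a. 0 < a \<Longrightarrow> f a = g a"
  shows "constant_term g c"
  using assms by (auto simp: constant_term_def)

definition laurent :: "nat \<Rightarrow> nat \<Rightarrow> nat \<Rightarrow> real \<Rightarrow> real" where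
  "laurent n s k a = (1 + a) ^ n * a ^ s / a ^ k"

lemma coeff_one_plus_X_power: "coeff ([:1, 1:] ^ n :: real poly) k = of_nat (n choose k)"
proof (cases "k \<le> n")
  case False
  then show ?thesis
    using degree_linear_power[of "1 :: real" n] by (simp add: coeff_eq_0 binomial_eq_0)
qed (simp add: coeff_linear_poly_power)

lemma constant_term_laurent:
  assumes "int k - int s = d"
  shows "constant_term (laurent n s k) (ibinom n d)"
proof -
  let ?p = "monom 1 s * [:1, 1:] ^ n :: real poly"
  have "coeff ?p k = ibinom n d"
  proof (cases "k < s")
    case True
    then show ?thesis using assms by (simp add: coeff_monom_mult)
  next
    case False
    then have "d = int (k - s)" using assms by simp
    then show ?thesis using False
      by (simp only: ibinom_of_nat coeff_monom_mult) (simp add: coeff_one_plus_X_power)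
  qed
  moreover have "a ^ k * laurent n s k a = poly ?p a" if "0 < a" for a
    using that by (simp add: laurent_def poly_monom algebra_simps)
  ultimately show ?thesis unfolding constant_term_def by blast
qed

lemma linear_power_nth:
  fixes b :: "'a :: comm_ring_1"
  shows "(fps_X + fps_const b) ^ m $ k = of_nat (m choose k) * b ^ (m - k)"
proof -
  have "(fps_X + fps_const b) ^ m $ k =
      (\<Sum>j\<le>m. (fps_X ^ j * fps_const (of_nat (m choose j) * b ^ (m - j))) $ k)"
    unfolding binomial_ring fps_sum_nth
    by (intro sum.cong refl arg_cong[where f = "\<lambda>f. f $ k"])
       (simp add: fps_of_nat[symmetric] fps_const_power mult.left_commute mult.commute
          flip: fps_const_mult)
  also have "\<dots> = (\<Sum>j\<le>m. if j = k then of_nat (m choose j) * b ^ (m - j) else 0)"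
    by (intro sum.cong refl) (auto simp: fps_X_power_mult_nth)
  also have "\<dots> = of_nat (m choose k) * b ^ (m - k)" by (auto simp: binomial_eq_0)
  finally show ?thesis .
qed

text \<open>
  The Cauchy product of the binomial expansions of \<open>(w + 1 + a)\<^sup>m\<close> and \<open>(w + a)\<^sup>m\<close>, summed so that \<open>i + 1\<close> is the exponent of
  \<open>1 + a\<close> taken from the first factor; the powers of \<open>a\<close> collect to \<open>a\<^sup>s\<^sup>-\<^sup>i\<close>.
\<close>

lemma orbit_kernel_power_nth:
  fixes a :: real
  assumes a: "0 < a" and m: "1 \<le> m"
  shows "(fps_X ^ s * (fps_const ((1 + a) / a) * (fps_X + fps_const (1 + a)) * (fps_X + fps_const a)) ^ m) $ (m - 1)
     = (\<Sum>i<m. ibinom m (int i + 1) * ibinom m (int i - int s) * laurent (m + i + 1) s i a)"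
proof -
  let ?L = "(fps_X + fps_const (1 + a)) ^ m" and ?g = "fps_X ^ s * (fps_X + fps_const a) ^ m"
  have g: "?g $ i = ibinom m (int i - int s) * (a ^ m * a ^ s / a ^ i)" for i
  proof (cases "i < s")
    case False
    then have eq: "int i - int s = int (i - s)" by simp
    show ?thesis
    proof (cases "i - s \<le> m")
      case True
      then have "a ^ (m - (i - s)) * a ^ i = a ^ m * a ^ s"
        using False by (simp flip: power_add)
      then have "a ^ (m - (i - s)) = a ^ m * a ^ s / a ^ i"
        using a by (simp add: field_simps)
      then show ?thesis using False
        unfolding eq ibinom_of_nat by (simp add: fps_X_power_mult_nth linear_power_nth)
    next
      case gt: False
      then show ?thesis using False
        unfolding eq ibinom_of_nat by (simp add: fps_X_power_mult_nth linear_power_nth binomial_eq_0)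
    qed
  qed (simp add: fps_X_power_mult_nth)
  have L: "?L $ (m - 1 - i) = ibinom m (int i + 1) * (1 + a) ^ (i + 1)" if "i < m" for i
  proof -
    have "m - (m - 1 - i) = i + 1" using that by simp
    moreover have "m choose (m - 1 - i) = m choose (i + 1)"
      using binomial_symmetric[of "i + 1" m] that by simp
    moreover have "int i + 1 = int (i + 1)" by simp
    ultimately show ?thesis unfolding linear_power_nth by (simp only: ibinom_of_nat)
  qed
  have "fps_X ^ s * (fps_const ((1 + a) / a) * (fps_X + fps_const (1 + a)) * (fps_X + fps_const a)) ^ m
      = fps_const (((1 + a) / a) ^ m) * (?g * ?L)"
    by (simp add: power_mult_distrib fps_const_power mult_ac)
  then have "(fps_X ^ s * (fps_const ((1 + a) / a) * (fps_X + fps_const (1 + a)) * (fps_X + fps_const a)) ^ m) $ (m - 1)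
      = ((1 + a) / a) ^ m * (?g * ?L) $ (m - 1)"
    by (simp only: fps_mult_left_const_nth)
  also have "(?g * ?L) $ (m - 1) = (\<Sum>i=0..m-1. ?g $ i * ?L $ (m - 1 - i))"
    by (rule fps_mult_nth)
  also have "{0..m-1} = {..<m}" using m by auto
  also have "((1 + a) / a) ^ m * (\<Sum>i<m. ?g $ i * ?L $ (m - 1 - i)) =
      (\<Sum>i<m. ibinom m (int i + 1) * ibinom m (int i - int s) * laurent (m + i + 1) s i a)"
    unfolding sum_distrib_left
  proof (intro sum.cong refl)
    fix i assume "i \<in> {..<m}"
    then have "?L $ (m - 1 - i) = ibinom m (int i + 1) * (1 + a) ^ (i + 1)" by (simp only: L lessThan_iff)
    then show "((1 + a) / a) ^ m * (?g $ i * ?L $ (m - 1 - i)) =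
        ibinom m (int i + 1) * ibinom m (int i - int s) * laurent (m + i + 1) s i a"
      unfolding g using a by (simp add: laurent_def power_divide power_add field_simps)
  qed
  finally show ?thesis .
qed

lemma label_poly_orbit_sum:
  fixes a :: real
  assumes a: "0 < a" and m: "1 \<le> m"
  shows "real m * (label_poly (Suc m) (1 + a) (1 + a) + (1 + a)\<^sup>2 / a ^ 4 * label_poly m 1 (1 + 1 / a)) =
    (\<Sum>i<m. ibinom m (int i + 1) *
       (ibinom m i * (2 * laurent (m + i + 2) 0 i a + laurent (m + i + 2) 0 (i + 5) a)
        + 2 * ibinom m (int i - 1) *
           (laurent (m + i + 1) 1 i a - laurent (m + i + 1) 0 i a - laurent (m + i + 1) 0 (i + 1) a
            + laurent (m + i + 1) 0 (i + 2) a - laurent (m + i + 1) 0 (i + 3) a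
            - laurent (m + i + 1) 0 (i + 4) a)
        + 3 * ibinom m (int i - 2) *
           (laurent (m + i + 1) 0 (i + 2) a - laurent (m + i + 1) 0 i a)))"
proof -
  let ?\<phi> = "fps_const ((1 + a) / a) * (fps_X + fps_const (1 + a)) * (fps_X + fps_const a)"
  define p1 p2 p3 where "p1 = (1 + a) * (2 + 1 / a ^ 5)"
    and "p2 = 1 - 1 / a - 1 / a ^ 2 + 1 / a ^ 3 - 1 / a ^ 4 - 1 / a ^ 5"
    and "p3 = 1 / a ^ 4 - 1 / a ^ 2"
  have "fps_deriv (orbit_sum_series a) = fps_const p1 * fps_X ^ 0 + fps_const (2 * p2) * fps_X ^ 1
      + fps_const (3 * p3) * fps_X ^ 2"
    unfolding orbit_sum_series_def p1_def[symmetric] p2_def[symmetric] p3_def[symmetric]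
    by (simp add: fps_deriv_power numeral_fps_const fps_eq_iff)
  then have "fps_deriv (orbit_sum_series a) * ?\<phi> ^ m = fps_const p1 * (fps_X ^ 0 * ?\<phi> ^ m)
      + fps_const (2 * p2) * (fps_X ^ 1 * ?\<phi> ^ m) + fps_const (3 * p3) * (fps_X ^ 2 * ?\<phi> ^ m)"
    by (simp only: distrib_right mult.assoc)
  then have "(fps_deriv (orbit_sum_series a) * ?\<phi> ^ m) $ (m - 1) =
      p1 * (fps_X ^ 0 * ?\<phi> ^ m) $ (m - 1) + 2 * p2 * (fps_X ^ 1 * ?\<phi> ^ m) $ (m - 1)
      + 3 * p3 * (fps_X ^ 2 * ?\<phi> ^ m) $ (m - 1)"
    by (simp only: fps_add_nth fps_mult_left_const_nth)
  also have "\<dots> = (\<Sum>i<m. ibinom m (int i + 1) *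
      (ibinom m i * (p1 * laurent (m + i + 1) 0 i a)
       + 2 * ibinom m (int i - 1) * (p2 * laurent (m + i + 1) 1 i a)
       + 3 * ibinom m (int i - 2) * (p3 * laurent (m + i + 1) 2 i a)))"
    unfolding orbit_kernel_power_nth[OF a m] sum_distrib_left sum.distrib[symmetric]
    by (intro sum.cong refl) (simp add: algebra_simps)
  also have "\<dots> = (\<Sum>i<m. ibinom m (int i + 1) *
       (ibinom m i * (2 * laurent (m + i + 2) 0 i a + laurent (m + i + 2) 0 (i + 5) a)
        + 2 * ibinom m (int i - 1) *
           (laurent (m + i + 1) 1 i a - laurent (m + i + 1) 0 i a - laurent (m + i + 1) 0 (i + 1) a
            + laurent (m + i + 1) 0 (i + 2) a - laurent (m + i + 1) 0 (i + 3) a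
            - laurent (m + i + 1) 0 (i + 4) a)
        + 3 * ibinom m (int i - 2) *
           (laurent (m + i + 1) 0 (i + 2) a - laurent (m + i + 1) 0 i a)))"
  proof (intro sum.cong refl arg_cong2[where f = "(*)"] arg_cong2[where f = "(+)"])
    fix i
    have nz: "a \<noteq> 0" using a by simp
    show "p1 * laurent (m + i + 1) 0 i a = 2 * laurent (m + i + 2) 0 i a + laurent (m + i + 2) 0 (i + 5) a"
      using nz by (simp add: p1_def laurent_def power_add field_simps eval_nat_numeral)
    show "p2 * laurent (m + i + 1) 1 i a = laurent (m + i + 1) 1 i a - laurent (m + i + 1) 0 i a
        - laurent (m + i + 1) 0 (i + 1) a + laurent (m + i + 1) 0 (i + 2) a
        - laurent (m + i + 1) 0 (i + 3) a - laurent (m + i + 1) 0 (i + 4) a"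
      using nz by (simp add: p2_def laurent_def power_add field_simps eval_nat_numeral)
    show "p3 * laurent (m + i + 1) 2 i a = laurent (m + i + 1) 0 (i + 2) a - laurent (m + i + 1) 0 i a"
      using nz by (simp add: p3_def laurent_def power_add field_simps eval_nat_numeral)
  qed
  finally show ?thesis
    unfolding label_poly_lagrange[OF assms] .
qed

text \<open>
  The constant term of the \<open>i\<close>-th summand in \<open>label_poly_orbit_sum\<close>.
\<close>

definition orbit_term :: "nat \<Rightarrow> nat \<Rightarrow> real" where
  "orbit_term m i = ibinom m (int i + 1) *
     (ibinom m i * (2 * ibinom (m + i + 2) i + ibinom (m + i + 2) (int i + 5))
      + 2 * ibinom m (int i - 1) *
          (ibinom (m + i + 1) (int i - 1) - ibinom (m + i + 1) i - ibinom (m + i + 1) (int i + 1)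
           + ibinom (m + i + 1) (int i + 2) - ibinom (m + i + 1) (int i + 3) - ibinom (m + i + 1) (int i + 4))
      + 3 * ibinom m (int i - 2) * (ibinom (m + i + 1) (int i + 2) - ibinom (m + i + 1) i))"

text \<open>
  In \<open>label_poly (Suc m) (1 + a) (1 + a)\<close> every permutation has constant term \<open>1\<close>. The other specialisation
  is a combination of \<open>(1 + a)\<^sup>k\<^sup>+\<^sup>2 / a\<^sup>k\<^sup>+\<^sup>4\<close>, whose largest exponent is \<open>-2\<close>, so it contributes nothing.
\<close>

lemma SB_orbit_terms:
  assumes m: "1 \<le> m"
  shows "real m * real (SB (Suc m)) = (\<Sum>i<m. orbit_term m i)"
proof -
  let ?B = "\<lambda>a :: real. label_poly (Suc m) (1 + a) (1 + a)"
    and ?A = "\<lambda>a :: real. (1 + a)\<^sup>2 / a ^ 4 * label_poly m 1 (1 + 1 / a)"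
  have "constant_term ?B (\<Sum>\<pi> | semi_baxter (Suc m) \<pi>. 1)"
    unfolding label_poly_def
  proof (rule constant_term_sum)
    fix \<pi>
    let ?n = "low_label (Suc m) \<pi> + high_label (Suc m) \<pi>"
    show "constant_term (\<lambda>a. (1 + a) ^ low_label (Suc m) \<pi> * (1 + a) ^ high_label (Suc m) \<pi>) 1"
      using constant_term_laurent[of 0 0 0 ?n]
      by (simp add: laurent_def[abs_def] power_add ibinom_of_nat[of _ 0, simplified])
  qed
  moreover have "constant_term ?A (\<Sum>\<pi> | semi_baxter m \<pi>. 0)"
  proof (rule constant_term_cong[OF constant_term_sum])
    fix \<pi>
    have "ibinom (2 + high_label m \<pi>) (int (4 + high_label m \<pi>)) = 0"
      unfolding ibinom_of_nat by simp
    then show "constant_term (laurent (2 + high_label m \<pi>) 0 (4 + high_label m \<pi>)) 0"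
      using constant_term_laurent[of "4 + high_label m \<pi>" 0 _ "2 + high_label m \<pi>", OF refl] by simp
  next
    fix a :: real assume a: "0 < a"
    then have "1 + 1 / a = (1 + a) / a" by (simp add: field_simps)
    then show "(\<Sum>\<pi> | semi_baxter m \<pi>. laurent (2 + high_label m \<pi>) 0 (4 + high_label m \<pi>) a) = ?A a"
      by (simp add: label_poly_def laurent_def sum_distrib_left power_add power_divide power2_eq_square mult.assoc)
  qed
  ultimately have "constant_term (\<lambda>a. real m * (?B a + ?A a)) (real m * ((\<Sum>\<pi> | semi_baxter (Suc m) \<pi>. 1) + (\<Sum>\<pi> | semi_baxter m \<pi>. 0)))"
    by (intro constant_term_mult_left constant_term_add)
  then have "constant_term (\<lambda>a. real m * (?B a + ?A a)) (real m * real (SB (Suc m)))"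
    by (simp add: SB_def)
  moreover have "constant_term (\<lambda>a. real m * (?B a + ?A a)) (\<Sum>i<m. orbit_term m i)"
  proof (rule constant_term_cong)
    show "constant_term (\<lambda>a. \<Sum>i<m. ibinom m (int i + 1) *
       (ibinom m i * (2 * laurent (m + i + 2) 0 i a + laurent (m + i + 2) 0 (i + 5) a)
        + 2 * ibinom m (int i - 1) *
           (laurent (m + i + 1) 1 i a - laurent (m + i + 1) 0 i a - laurent (m + i + 1) 0 (i + 1) a
            + laurent (m + i + 1) 0 (i + 2) a - laurent (m + i + 1) 0 (i + 3) a
            - laurent (m + i + 1) 0 (i + 4) a)
        + 3 * ibinom m (int i - 2) *
           (laurent (m + i + 1) 0 (i + 2) a - laurent (m + i + 1) 0 i a))) (\<Sum>i<m. orbit_term m i)"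
      unfolding orbit_term_def
      by (intro constant_term_sum constant_term_mult_left constant_term_add constant_term_diff
          constant_term_laurent) simp_all
  qed (simp only: label_poly_orbit_sum[OF _ m])
  ultimately show ?thesis by (rule constant_term_unique)
qed

section \<open>Telescoping to the recurrence\<close>

text \<open>
  Up to a factor depending on \<open>N\<close> only, this is \<open>(N choose (j + 2)) ((N + 2) choose j) ((N + j + 2) choose (j + 1))\<close>.
\<close>

definition hyper_term :: "nat \<Rightarrow> nat \<Rightarrow> real" where
  "hyper_term N j = fact (N + j + 2) * rfact j * rfact (int j + 1) * rfact (int j + 2)
     * rfact (int N - 2 - j) * rfact (int N + 2 - j)"

text \<open>
  The polynomial part of a certificate found by Gosper's method: at each fixed \<open>x\<close> the telescoping
  equation is linear in the coefficients of the powers of \<open>y\<close>, and these are interpolated in \<open>x\<close>.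
\<close>

definition orbit_certificate :: "real \<Rightarrow> real \<Rightarrow> real" where
  "orbit_certificate x y =
     864 + 1080 * x + 20 * x ^ 2 - 218 * x ^ 3 - 21 * x ^ 4 - 2 * x ^ 5 + 4 * x ^ 7 + x ^ 8
     + (1944 + 2136 * x + 844 * x ^ 2 + 165 * x ^ 3 - 22 * x ^ 4 - 20 * x ^ 5 - 6 * x ^ 6 - x ^ 7) * y
     + (1416 + 1600 * x + 833 * x ^ 2 + 225 * x ^ 3 + 17 * x ^ 4 - 9 * x ^ 5 - 2 * x ^ 6) * y ^ 2
     + (270 + 357 * x + 248 * x ^ 2 + 83 * x ^ 3 + 13 * x ^ 4 + x ^ 5) * y ^ 3
     + (- 114 - 83 * x + 3 * x ^ 2 + 12 * x ^ 3 + 2 * x ^ 4) * y ^ 4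
     - (54 + 45 * x + 9 * x ^ 2) * y ^ 5
     - (6 + 5 * x + x ^ 2) * y ^ 6"

text \<open>
  The difference of the two summands, suitably scaled, telescopes. To verify this, both sides are
  written as polynomials times the common product \<open>c\<close>, which takes each reciprocal factorial at the
  largest argument that occurs; all others differ from it by polynomial factors. The factor
  \<open>(x + 2) (x + 3)\<close> is the denominator of the certificate.
\<close>

lemma sum_orbit_term_eq_sum_hyper_term:
  shows "fact (m + 2) * (\<Sum>i<m. orbit_term m i) = 24 * (fact m)\<^sup>2 * (\<Sum>i<Suc m. hyper_term (Suc m) i)"
proof -
  define x where "x = real (Suc m)"
  define G where "G i = orbit_certificate x (real i) * rfact (int i - 1) * rfact i * rfact (int i + 4)
     * rfact (int m - 1 - i) * rfact (int m + 3 - i) * fact (m + 1 + i)" for i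
  have step: "(x + 2) * (x + 3) * fact (m + 2) * orbit_term m i =
      (fact m)\<^sup>2 * (24 * (x + 2) * (x + 3) * hyper_term (Suc m) i + (G (Suc i) - G i))" for i
  proof -
    define y where "y = real i"
    define r0 r1 r5 where "r0 = rfact i" and "r1 = rfact (int i + 1)" and "r5 = rfact (int i + 5)"
    define s t h where "s = rfact (int m - 1 - i)" and "t = rfact (int m + 3 - i)" and "h = rfact (m + 2)"
    define f F where "f = (fact (m + 1 + i) :: real)" and "F = (fact m :: real)"
    have h: "fact (m + 2) * h = 1" unfolding h_def rfact_of_nat by simp
    have ri: "rfact (int i - 1) = y * r0" "rfact (int i - 2) = (y - 1) * rfact (int i - 1)" "r0 = (y + 1) * r1"
      unfolding r0_def r1_def by (rule rfact_step; simp add: y_def)+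
    have r: "rfact (int i - 1) = y * rfact i" "rfact i = (y + 1) * rfact (int i + 1)"
      "rfact (int i + 1) = (y + 2) * rfact (int i + 2)" "rfact (int i + 2) = (y + 3) * rfact (int i + 3)"
      "rfact (int i + 3) = (y + 4) * rfact (int i + 4)" "rfact (int i + 4) = (y + 5) * r5"
      unfolding r5_def by (rule rfact_step; simp add: y_def)+
    have sp: "rfact (int m - 2 - i) = (x - 2 - y) * s"
      unfolding s_def by (rule rfact_step; simp add: x_def y_def)
    have t: "rfact (int m - i) = (x - y) * rfact (int m + 1 - i)"
      "rfact (int m + 1 - i) = (x + 1 - y) * rfact (int m + 2 - i)"
      "rfact (int m + 2 - i) = (x + 2 - y) * t"
      unfolding t_def by (rule rfact_step; simp add: x_def y_def)+
    have hs: "rfact (int m - 3) = (x - 3) * rfact (int m - 2)" "rfact (int m - 2) = (x - 2) * rfact (int m - 1)"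
      "rfact (int m - 1) = (x - 1) * rfact m" "rfact m = x * rfact (int m + 1)"
      "rfact (int m + 1) = (x + 1) * h"
      unfolding h_def by (rule rfact_step; simp add: x_def)+
    have fp: "fact (m + i + 2) = (x + y + 1) * f" "fact (m + i + 3) = (x + y + 2) * (x + y + 1) * f"
    proof -
      have "m + i + 2 = Suc (m + 1 + i)" "m + i + 3 = Suc (Suc (m + 1 + i))" by simp_all
      then show "fact (m + i + 2) = (x + y + 1) * f" "fact (m + i + 3) = (x + y + 2) * (x + y + 1) * f"
        by (simp_all only: fact_Suc f_def) (simp_all add: x_def y_def algebra_simps)
    qed
    have b1: "ibinom m (int i + 1) = F * r1 * s"
      by (simp add: ibinom_def F_def r1_def s_def algebra_simps)
    have b2: "ibinom m i = F * r0 * ((x - y) * (x + 1 - y) * (x + 2 - y) * t)"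
      by (simp add: ibinom_def F_def r0_def t[unfolded mult.assoc[symmetric]])
    have "ibinom m (int i - 1) = F * rfact (int i - 1) * rfact (int m + 1 - i)"
      by (simp add: ibinom_def F_def algebra_simps)
    then have b3: "ibinom m (int i - 1) = F * (y * r0) * ((x + 1 - y) * (x + 2 - y) * t)"
      unfolding ri t by simp
    have "ibinom m (int i - 2) = F * rfact (int i - 2) * rfact (int m + 2 - i)"
      by (simp add: ibinom_def F_def algebra_simps)
    then have b4: "ibinom m (int i - 2) = F * (y * (y - 1) * r0) * ((x + 2 - y) * t)"
      unfolding ri t by simp
    have c0: "ibinom (m + i + 2) i = (x + y + 1) * f * rfact i * h"
      unfolding ibinom_def fp by (simp add: h_def)
    have c5: "ibinom (m + i + 2) (int i + 5) = (x + y + 1) * f * r5 * rfact (int m - 3)"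
      unfolding ibinom_def fp by (simp add: r5_def algebra_simps)
    have d: "ibinom (m + i + 1) (int i - 1) = f * rfact (int i - 1) * h"
      "ibinom (m + i + 1) i = f * rfact i * rfact (int m + 1)"
      "ibinom (m + i + 1) (int i + 1) = f * rfact (int i + 1) * rfact (int m)"
      "ibinom (m + i + 1) (int i + 2) = f * rfact (int i + 2) * rfact (int m - 1)"
      "ibinom (m + i + 1) (int i + 3) = f * rfact (int i + 3) * rfact (int m - 2)"
      "ibinom (m + i + 1) (int i + 4) = f * rfact (int i + 4) * rfact (int m - 3)"
      by (simp_all add: ibinom_def f_def h_def algebra_simps)
    define c where "c = F\<^sup>2 * r0 * r1 * r5 * s * t * f"
    have "hyper_term (Suc m) i = fact (m + i + 3) * rfact i * rfact (int i + 1) * rfact (int i + 2) * s * t"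
    proof -
      have "Suc m + i + 2 = m + i + 3" "int (Suc m) - 2 - int i = int m - 1 - int i"
        "int (Suc m) + 2 - int i = int m + 3 - int i" by simp_all
      then show ?thesis unfolding hyper_term_def s_def t_def by (simp only:)
    qed
    then have H: "F\<^sup>2 * hyper_term (Suc m) i = (x + y + 2) * (x + y + 1) * (y + 3) * (y + 4) * (y + 5) * c"
      unfolding fp r(4-6) c_def by (simp add: r0_def r1_def)
    have "G i = orbit_certificate x y * rfact (int i - 1) * r0 * rfact (int i + 4) * s * t * f"
      by (simp add: G_def y_def r0_def s_def t_def f_def)
    also have "\<dots> = orbit_certificate x y * (y * r0) * ((y + 1) * r1) * ((y + 5) * r5) * s * t * f"
      unfolding ri(1) r(6) using ri(3) by simp
    finally have G0: "F\<^sup>2 * G i = orbit_certificate x y * (y * (y + 1) * (y + 5)) * c"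
      by (simp add: c_def)
    have "G (Suc i) = orbit_certificate x (y + 1) * r0 * r1 * r5 * rfact (int m - 2 - i) * rfact (int m + 2 - i)
        * fact (m + i + 2)"
      by (simp add: G_def y_def r0_def r1_def r5_def algebra_simps)
    then have G1: "F\<^sup>2 * G (Suc i) = orbit_certificate x (y + 1) * ((x - 2 - y) * (x + 2 - y) * (x + y + 1)) * c"
      unfolding sp t(3) fp c_def by simp
    \<comment> \<open>The polynomials e, e' and e'' stem from the coefficients of w, of its square and of its cube in the orbit series.\<close>
    define e where "e = 2 * ((x + y + 1) * ((y + 1) * (y + 2) * (y + 3) * (y + 4) * (y + 5)))
      + (x + y + 1) * ((x - 3) * (x - 2) * (x - 1) * x * (x + 1))"
    have e: "2 * ibinom (m + i + 2) i + ibinom (m + i + 2) (int i + 5) = e * (f * r5 * h)"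
      unfolding c0 c5 r hs e_def by algebra
    define e' where "e' = y * (y + 1) * (y + 2) * (y + 3) * (y + 4) * (y + 5)
      - (y + 1) * (y + 2) * (y + 3) * (y + 4) * (y + 5) * (x + 1)
      - (y + 2) * (y + 3) * (y + 4) * (y + 5) * (x * (x + 1))
      + (y + 3) * (y + 4) * (y + 5) * ((x - 1) * x * (x + 1))
      - (y + 4) * (y + 5) * ((x - 2) * (x - 1) * x * (x + 1))
      - (y + 5) * ((x - 3) * (x - 2) * (x - 1) * x * (x + 1))"
    have e': "ibinom (m + i + 1) (int i - 1) - ibinom (m + i + 1) i - ibinom (m + i + 1) (int i + 1)
           + ibinom (m + i + 1) (int i + 2) - ibinom (m + i + 1) (int i + 3) - ibinom (m + i + 1) (int i + 4)
        = e' * (f * r5 * h)"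
      unfolding d r hs e'_def by algebra
    define e'' where "e'' = (y + 3) * (y + 4) * (y + 5) * ((x - 1) * x * (x + 1))
      - (y + 1) * (y + 2) * (y + 3) * (y + 4) * (y + 5) * (x + 1)"
    have e'': "ibinom (m + i + 1) (int i + 2) - ibinom (m + i + 1) i = e'' * (f * r5 * h)"
      unfolding d r hs e''_def by algebra
    have "orbit_term m i = h * c *
        ((x - y) * (x + 1 - y) * (x + 2 - y) * e + 2 * (y * (x + 1 - y) * (x + 2 - y)) * e'
         + 3 * (y * (y - 1) * (x + 2 - y)) * e'')" (is "_ = h * c * ?p")
      unfolding orbit_term_def b1 b2 b3 b4 e e' e'' c_def by algebra
    then have "fact (m + 2) * orbit_term m i = (fact (m + 2) * h) * (c * ?p)"
      by (simp only: mult.assoc)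
    then have O: "fact (m + 2) * orbit_term m i = c * ?p" unfolding h by simp
    have "(x + 2) * (x + 3) * (fact (m + 2) * orbit_term m i) =
        24 * (x + 2) * (x + 3) * (F\<^sup>2 * hyper_term (Suc m) i) + (F\<^sup>2 * G (Suc i) - F\<^sup>2 * G i)"
      unfolding O H G0 G1 e_def e'_def e''_def orbit_certificate_def by algebra
    then show ?thesis unfolding F_def by (simp only: distrib_left right_diff_distrib mult.assoc mult.left_commute)
  qed
  have "(x + 2) * (x + 3) * (fact (m + 2) * (\<Sum>i<Suc m. orbit_term m i)) =
      (\<Sum>i<Suc m. (fact m)\<^sup>2 * (24 * (x + 2) * (x + 3) * hyper_term (Suc m) i + (G (Suc i) - G i)))"
    unfolding step[symmetric] by (simp only: sum_distrib_left mult.assoc)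
  also have "\<dots> = (fact m)\<^sup>2 * (24 * (x + 2) * (x + 3) * (\<Sum>i<Suc m. hyper_term (Suc m) i) + (G (Suc m) - G 0))"
    by (simp only: sum_distrib_left[symmetric] sum.distrib sum_lessThan_telescope)
  also have "G (Suc m) - G 0 = 0" by (simp add: G_def)
  finally have "(x + 2) * (x + 3) * (fact (m + 2) * (\<Sum>i<Suc m. orbit_term m i)) =
      (x + 2) * (x + 3) * (24 * (fact m)\<^sup>2 * (\<Sum>i<Suc m. hyper_term (Suc m) i))"
    by (simp only: add_0_right mult.assoc mult.left_commute)
  moreover have "x + 2 \<noteq> 0" "x + 3 \<noteq> 0" by (simp_all add: x_def)
  moreover have "orbit_term m m = 0" by (simp add: orbit_term_def ibinom_def)
  ultimately show ?thesis by simp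
qed

lemma SB_closed_form:
  assumes "2 \<le> n"
  shows "real n * (real n + 1) * real (SB n) = 24 * fact (n - 2) * (\<Sum>j<n. hyper_term n j)"
proof -
  obtain k where k: "n = Suc (Suc k)" using assms by (cases n; cases "n - 1") auto
  have "fact (Suc k + 2) * (real (Suc k) * real (SB n)) = 24 * (fact (Suc k))\<^sup>2 * (\<Sum>j<n. hyper_term n j)"
    using SB_orbit_terms[of "Suc k"] sum_orbit_term_eq_sum_hyper_term[of "Suc k"] by (simp add: k)
  moreover have "fact (Suc k + 2) = (real n + 1) * real n * fact (Suc k)"
    by (simp add: k algebra_simps)
  moreover have "fact (Suc k) = real (Suc k) * fact k" by simp
  ultimately have "(fact (Suc k) * real (Suc k)) * (real n * (real n + 1) * real (SB n)) =
      (fact (Suc k) * real (Suc k)) * (24 * fact k * (\<Sum>j<n. hyper_term n j))"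
    by algebra
  then show ?thesis by (simp add: k del: of_nat_Suc fact_Suc)
qed

text \<open>
  The coefficients are those of the recurrence for \<open>SB\<close>, adjusted by the factor \<open>(N - 2)! / (N (N + 1))\<close> of
  the closed form. By Zeilberger's method the summands satisfy it up to a difference \<open>G (j + 1) - G j\<close>, and
  \<open>G\<close> vanishes at both ends because a reciprocal factorial is taken at a negative integer. The quadratic
  factor of \<open>G\<close> solves, for each \<open>x\<close>, a linear system for its coefficients.
\<close>

lemma sum_hyper_term_recurrence:
  assumes "2 \<le> N"
  defines "x \<equiv> real N"
  shows "(x + 4) * (x + 3) * (x - 2) * (x - 1) * (\<Sum>j<N. hyper_term N j) =
     (11 * x\<^sup>2 + 11 * x - 6) * (x + 1) * (\<Sum>j<N - 1. hyper_term (N - 1) j) +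
     x * (x + 1) * (\<Sum>j<N - 2. hyper_term (N - 2) j)"
proof -
  obtain n where N: "N = n + 2" using assms(1) by (metis add.commute le_Suc_ex)
  define G where "G j = (2 - 7 * x - 20 * x\<^sup>2 - 11 * x ^ 3 + (6 * x\<^sup>2 + 9 * x - 9) * real j + (x + 1) * (real j)\<^sup>2)
     * rfact (int j - 1) * rfact j * rfact (int j + 1) * fact (N + j)
     * rfact (int N - 2 - j) * rfact (int N + 2 - j)" for j
  have step: "(x + 4) * (x + 3) * (x - 2) * (x - 1) * hyper_term N j
      - (11 * x\<^sup>2 + 11 * x - 6) * (x + 1) * hyper_term (N - 1) j - x * (x + 1) * hyper_term (N - 2) j
      = G (Suc j) - G j" for j
  proof -
    define y where "y = real j"
    define r0 r1 r2 where "r0 = rfact j" and "r1 = rfact (int j + 1)" and "r2 = rfact (int j + 2)"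
    define s t f where "s = rfact (int N - 2 - j)" and "t = rfact (int N + 2 - j)" and "f = (fact (N + j) :: real)"
    have rf: "rfact (int j - 1) = y * r0" "r0 = (y + 1) * r1" "r1 = (y + 2) * r2"
      unfolding r0_def r1_def r2_def by (rule rfact_step; simp add: y_def)+
    have sp: "rfact (int N - 3 - j) = (x - 2 - y) * s"
      "rfact (int N - 4 - j) = (x - 3 - y) * rfact (int N - 3 - j)"
      unfolding s_def by (rule rfact_step; simp add: x_def y_def)+
    have tp: "rfact (int N + 1 - j) = (x + 2 - y) * t"
      "rfact (int N - j) = (x + 1 - y) * rfact (int N + 1 - j)"
      unfolding t_def by (rule rfact_step; simp add: x_def y_def)+
    have fp: "fact (N + j + 1) = (x + y + 1) * f" "fact (N + j + 2) = (x + y + 2) * ((x + y + 1) * f)"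
      by (simp_all add: f_def x_def y_def algebra_simps)
    have h0: "hyper_term N j = (x + y + 2) * (x + y + 1) * f * r0 * r1 * r2 * s * t"
      unfolding hyper_term_def fp by (simp add: r0_def r1_def r2_def s_def t_def)
    have "hyper_term (N - 1) j = fact (N + j + 1) * r0 * r1 * r2 * rfact (int N - 3 - j) * rfact (int N + 1 - j)"
      by (simp add: hyper_term_def N r0_def r1_def r2_def algebra_simps)
    then have h1: "hyper_term (N - 1) j = (x + y + 1) * (x - 2 - y) * (x + 2 - y) * f * r0 * r1 * r2 * s * t"
      unfolding fp sp tp by simp
    have "hyper_term (N - 2) j = fact (N + j) * r0 * r1 * r2 * rfact (int N - 4 - j) * rfact (int N - j)"
      by (simp add: hyper_term_def N r0_def r1_def r2_def algebra_simps)
    then have h2: "hyper_term (N - 2) j = (x - 3 - y) * (x - 2 - y) * (x + 1 - y) * (x + 2 - y) * f * r0 * r1 * r2 * s * t"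
      unfolding sp tp by (simp add: f_def)
    have g0: "G j = (2 - 7 * x - 20 * x\<^sup>2 - 11 * x ^ 3 + (6 * x\<^sup>2 + 9 * x - 9) * y + (x + 1) * y\<^sup>2)
        * (y * (y + 1) * (y + 2)) * f * r0 * r1 * r2 * s * t"
    proof -
      have "G j = (2 - 7 * x - 20 * x\<^sup>2 - 11 * x ^ 3 + (6 * x\<^sup>2 + 9 * x - 9) * y + (x + 1) * y\<^sup>2)
        * rfact (int j - 1) * r0 * r1 * f * s * t"
        by (simp add: G_def y_def r0_def r1_def f_def s_def t_def)
      then show ?thesis unfolding rf(1) using rf(2,3) by algebra
    qed
    have "G (Suc j) = (2 - 7 * x - 20 * x\<^sup>2 - 11 * x ^ 3 + (6 * x\<^sup>2 + 9 * x - 9) * (y + 1) + (x + 1) * (y + 1)\<^sup>2)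
        * r0 * r1 * r2 * fact (N + j + 1) * rfact (int N - 3 - j) * rfact (int N + 1 - j)"
      by (simp add: G_def y_def r0_def r1_def r2_def algebra_simps)
    then have g1: "G (Suc j) = (2 - 7 * x - 20 * x\<^sup>2 - 11 * x ^ 3 + (6 * x\<^sup>2 + 9 * x - 9) * (y + 1) + (x + 1) * (y + 1)\<^sup>2)
        * ((x + y + 1) * (x - 2 - y) * (x + 2 - y)) * f * r0 * r1 * r2 * s * t"
      unfolding fp sp tp by simp
    show ?thesis unfolding h0 h1 h2 g0 g1 by algebra
  qed
  have pad: "(\<Sum>j<N - k. hyper_term (N - k) j) = (\<Sum>j<N. hyper_term (N - k) j)" if "k \<le> 2" for k
    using that by (intro sum.mono_neutral_left) (auto simp: hyper_term_def)
  have "(\<Sum>j<N. (x + 4) * (x + 3) * (x - 2) * (x - 1) * hyper_term N j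
      - (11 * x\<^sup>2 + 11 * x - 6) * (x + 1) * hyper_term (N - 1) j - x * (x + 1) * hyper_term (N - 2) j) = G N - G 0"
    unfolding step by (rule sum_lessThan_telescope)
  also have "\<dots> = 0" by (simp add: G_def)
  finally show ?thesis
    unfolding pad[OF one_le_numeral] pad[OF order_refl]
    by (simp add: sum_subtractf sum_distrib_left)
qed

lemma SB_1: "SB 1 = 1"
  using semi_baxter_1 by (simp add: SB_def)

lemma SB_2: "SB 2 = 2"
  using SB_closed_form[of 2] by (simp add: hyper_term_def rfact_def eval_nat_numeral)

lemma SB_3: "SB 3 = 6"
  using SB_closed_form[of 3] by (simp add: hyper_term_def rfact_def eval_nat_numeral)

text \<open>
  For \<open>n \<ge> 4\<close> all three terms are given by the closed form, which is valid from size \<open>2\<close> on. In the two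
  remaining cases the coefficient of the second term is zero.
\<close>

lemma SB_recurrence:
  assumes "2 \<le> n"
  shows "real (SB n) =
       (11 * real n ^ 2 + 11 * real n - 6) / ((real n + 4) * (real n + 3)) * real (SB (n - 1)) +
       ((real n - 3) * (real n - 2)) / ((real n + 4) * (real n + 3)) * real (SB (n - 2))"
proof -
  consider "n = 2" | "n = 3" | "4 \<le> n" using assms by linarith
  then show ?thesis
  proof cases
    case 1
    then show ?thesis by (simp add: SB_2 SB_1[simplified])
  next
    case 2
    then show ?thesis by (simp add: SB_2 SB_3)
  next
    case 3
    then obtain k where k: "n = k + 4" by (metis add.commute le_Suc_ex)
    define x where "x = real n"
    define F U0 U1 U2 where "F = (fact k :: real)" and "U0 = (\<Sum>j<n. hyper_term n j)"
      and "U1 = (\<Sum>j<n - 1. hyper_term (n - 1) j)" and "U2 = (\<Sum>j<n - 2. hyper_term (n - 2) j)"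
    have x: "4 \<le> x" using 3 by (simp add: x_def)
    have f: "fact (n - 2) = (x - 2) * (x - 3) * F" "fact (n - 1 - 2) = (x - 3) * F" "fact (n - 2 - 2) = F"
      by (simp_all add: k F_def x_def eval_nat_numeral algebra_simps)
    have S0: "x * (x + 1) * real (SB n) = 24 * ((x - 2) * (x - 3) * F) * U0"
      using SB_closed_form[of n] 3 unfolding f U0_def x_def by simp
    have S1: "(x - 1) * x * real (SB (n - 1)) = 24 * ((x - 3) * F) * U1"
      using SB_closed_form[of "n - 1"] 3 unfolding f U1_def x_def by (simp add: of_nat_diff)
    have S2: "(x - 2) * (x - 1) * real (SB (n - 2)) = 24 * F * U2"
      using SB_closed_form[of "n - 2"] 3 unfolding f U2_def x_def by (simp add: of_nat_diff)
    have "(x + 4) * (x + 3) * (x - 2) * (x - 1) * U0 =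
        (11 * x\<^sup>2 + 11 * x - 6) * (x + 1) * U1 + x * (x + 1) * U2"
      using sum_hyper_term_recurrence[of n] 3 unfolding U0_def U1_def U2_def x_def by simp
    then have "(x * (x + 1) * (x - 1)) * ((x + 4) * (x + 3) * real (SB n)) =
        (x * (x + 1) * (x - 1)) *
        ((11 * x\<^sup>2 + 11 * x - 6) * real (SB (n - 1)) + (x - 3) * (x - 2) * real (SB (n - 2)))"
      using S0 S1 S2 by algebra
    then have "(x + 4) * (x + 3) * real (SB n) =
        (11 * x\<^sup>2 + 11 * x - 6) * real (SB (n - 1)) + (x - 3) * (x - 2) * real (SB (n - 2))"
      using x by simp
    moreover have "(x + 4) * (x + 3) \<noteq> 0" using x by simp
    ultimately have "real (SB n) =
        ((11 * x\<^sup>2 + 11 * x - 6) * real (SB (n - 1)) + (x - 3) * (x - 2) * real (SB (n - 2))) / ((x + 4) * (x + 3))"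
      by (metis nonzero_mult_div_cancel_left)
    then show ?thesis by (simp only: x_def add_divide_distrib times_divide_eq_left)
  qed
qed

theorem proposition13:
  shows "SB 0 = 0 \<and> SB 1 = 1 \<and>
    (\<forall>n\<ge>2. real (SB n) =
       (11 * real n ^ 2 + 11 * real n - 6) / ((real n + 4) * (real n + 3)) * real (SB (n - 1)) +
       ((real n - 3) * (real n - 2)) / ((real n + 4) * (real n + 3)) * real (SB (n - 2))) \<and>
    (\<forall>f :: nat \<Rightarrow> real.
       f 0 = 0 \<and> f 1 = 1 \<and>
       (\<forall>n\<ge>2. f n =
          (11 * real n ^ 2 + 11 * real n - 6) / ((real n + 4) * (real n + 3)) * f (n - 1) +
          ((real n - 3) * (real n - 2)) / ((real n + 4) * (real n + 3)) * f (n - 2))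
       \<longrightarrow> (\<forall>n. f n = real (SB n)))"
proof (intro conjI allI impI)
  show "SB 0 = 0" by (simp add: SB_def)
  show "SB 1 = 1" by (rule SB_1)
next
  fix n :: nat assume "2 \<le> n"
  then show "real (SB n) =
       (11 * real n ^ 2 + 11 * real n - 6) / ((real n + 4) * (real n + 3)) * real (SB (n - 1)) +
       ((real n - 3) * (real n - 2)) / ((real n + 4) * (real n + 3)) * real (SB (n - 2))"
    by (rule SB_recurrence)
next
  fix f :: "nat \<Rightarrow> real" and n
  assume f: "f 0 = 0 \<and> f 1 = 1 \<and>
       (\<forall>n\<ge>2. f n =
          (11 * real n ^ 2 + 11 * real n - 6) / ((real n + 4) * (real n + 3)) * f (n - 1) +
          ((real n - 3) * (real n - 2)) / ((real n + 4) * (real n + 3)) * f (n - 2))"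
  show "f n = real (SB n)"
  proof (induction n rule: less_induct)
    case (less n)
    show ?case
    proof (cases "2 \<le> n")
      case True
      then have "f (n - 1) = real (SB (n - 1))" "f (n - 2) = real (SB (n - 2))"
        using less by simp_all
      with f True SB_recurrence[OF True] show ?thesis by simp
    next
      case False
      then have "n = 0 \<or> n = 1" by auto
      then show ?thesis using f SB_1 by (auto simp: SB_def)
    qed
  qed
qed

end
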